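(* Let $f:\mathbb{R}\to\mathbb{R}$ be a smooth function, and let $\mathcal{M}_f=(\mathbb{R}^3,g_f)$ be the Lorentz manifold with coordinates $(x,y,\tilde x)$ on $\mathbb{R}^3$ whose metric has as its only non-zero components (up to symmetry) $$g_f(\partial_x,\partial_x)=-2f(y),\qquad g_f(\partial_x,\partial_{\tilde x})=g_f(\partial_y,\partial_y)=1.$$ For $\varepsilon\in\{+1,-1\}$ let $\mathcal{S}_\varepsilon:=\mathcal{M}_{f_\varepsilon}$ with $f_\varepsilon(y)=\frac12\varepsilon y^2$. Then: (1) All scalar Weyl invariants of $\mathcal{M}_f$ vanish. (2) $\mathcal{S}_\varepsilon$ is an indecomposable local symmetric space. (3) If $f''(y)\neq 0$ for all $y\in\mathbb{R}$, then $\mathcal{M}_f$ is $0$-curvature modeled on $\mathcal{S}_\varepsilon$ for $\varepsilon=\operatorname{sign}(f'')$. (4) Assume that $f''(y)\ne 0$ and $f'''(y)\neq 0$ for all $y\in\mathbb{R}$. Then: (4a) $\mathcal{M}_f$ is $1$-affine curvature homogeneous. (4b) $\mathcal{M}_f$ is $1$-curvature homogeneous if and only if there are real constants $a,b$ with $f''(y)=ae^{by}$ for all $y$. (4c) The following assertions are equivalent: (i) $\mathcal{M}_f$ is locally homogeneous; (ii) $\mathcal{M}_f$ is $k$-curvature homogeneous for all $k$; (iii) $\mathcal{M}_f$ is $2$-curvature homogeneous; (iv) $\mathcal{M}_f$ is $2$-affine curvature homogeneous; (v) there are real constants $a,b$ with $f'(y)=ae^{by}$ for all $y$.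
   Context: For a pseudo-Riemannian manifold $\mathcal{M}=(M,g)$, $\nabla$ is the Levi-Civita connection, $\mathcal{R}(X,Y)=\nabla_X\nabla_Y-\nabla_Y\nabla_X-\nabla_{[X,Y]}$ is the curvature operator, and $R(X,Y,Z,W)=g(\mathcal{R}(X,Y)Z,W)$ is the curvature tensor; $\nabla^iR$ and $\nabla^i\mathcal{R}$ are the $i$-th covariant derivatives (with $\nabla^0R=R$, $\nabla^0\mathcal{R}=\mathcal{R}$). Scalar Weyl invariants: the scalar functions obtained by taking tensor products of the covariant derivatives $\nabla^kR$ ($k\ge0$, at least one factor) and contracting all indices in pairs with the metric (for example the scalar curvature $\tau$, $|\rho|^2$ with $\rho$ the Ricci tensor, $|R|^2$), and linear combinations of these. Local symmetric space: $\nabla R=0$. Indecomposable: at no point $P$ is there a non-trivial $g_P$-orthogonal direct sum decomposition $T_PM=V_1\oplus V_2$ inducing a splitting $R_P=R_1\oplus R_2$ of the curvature tensor with $R_i\in\otimes^4V_i^*$. $\mathcal{M}$ is locally homogeneous if for any $P,Q\in M$ there is an isometry $\Phi$ from a neighborhood of $P$ to a neighborhood of $Q$ with $\Phi(P)=Q$. $\mathcal{M}$ is $k$-curvature homogeneous if for any $P,Q\in M$ there is a linear isometry $\phi:T_PM\to T_QM$ with $\phi^*\nabla^iR_Q=\nabla^iR_P$ for $0\le i\le k$. $\mathcal{M}$ is $k$-affine curvature homogeneous if for any $P,Q\in M$ there is a linear isomorphism $\phi:T_PM\to T_QM$ (not necessarily an isometry) with $\phi^*\nabla^i\mathcal{R}_Q=\nabla^i\mathcal{R}_P$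 for $0\le i\le k$. $\mathcal{M}$ is $0$-curvature modeled on $\mathcal{N}$ if for every point $P$ of $\mathcal{M}$ and every point $Q$ of $\mathcal{N}$ there is a linear isometry $\phi$ from the tangent space of $\mathcal{M}$ at $P$ to that of $\mathcal{N}$ at $Q$ with $\phi^*R_Q=R_P$. *)

theory Defs
  imports "HOL-Analysis.Analysis"
begin

section \<open>Smooth maps\<close>

text \<open>For an open set \<open>S\<close> this is the usual notion: a map is of class \<open>C\<^sup>k\<^sup>+\<^sup>1\<close> iff it is
  differentiable and all its directional derivatives are of class \<open>C\<^sup>k\<close>.\<close>

primrec Ck_on ::
  "nat \<Rightarrow> 'a::euclidean_space set \<Rightarrow> ('a \<Rightarrow> 'b::real_normed_vector) \<Rightarrow> bool" where
  "Ck_on 0 S f \<longleftrightarrow> continuous_on S f"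
| "Ck_on (Suc k) S f \<longleftrightarrow> (\<forall>p\<in>S. f differentiable at p) \<and>
     (\<forall>v. Ck_on k S (\<lambda>p. frechet_derivative f (at p) v))"

definition smooth_on :: "'a::euclidean_space set \<Rightarrow> ('a \<Rightarrow> 'b::real_normed_vector) \<Rightarrow> bool" where
  "smooth_on S f \<longleftrightarrow> (\<forall>k. Ck_on k S f)"


section \<open>Pseudo-Riemannian metrics on \<open>\<real>\<^sup>n\<close>\<close>

text \<open>All manifolds considered have underlying manifold \<open>\<real>\<^sup>n\<close>, with every tangent space identified
  with \<open>\<real>\<^sup>n\<close> by means of the coordinate frame. A metric is given by the matrices
  \<open>g p $ i $ j\<close> of its components.\<close>

type_synonym 'n metric = "real^'n \<Rightarrow> real^'n^'n"
type_synonym 'n vfield = "real^'n \<Rightarrow> real^'n"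

definition ip :: "'n::finite metric \<Rightarrow> real^'n \<Rightarrow> real^'n \<Rightarrow> real^'n \<Rightarrow> real" where
  "ip g p u v = u \<bullet> (g p *v v)"

text \<open>Signature \<open>(1, n - 1)\<close>, with one negative direction.\<close>

definition lorentzian :: "'n::finite metric \<Rightarrow> bool" where
  "lorentzian g \<longleftrightarrow> smooth_on UNIV g \<and> (\<forall>p. transpose (g p) = g p) \<and>
     (\<forall>p. \<exists>u. ip g p u u < 0 \<and> (\<forall>v. v \<noteq> 0 \<and> ip g p u v = 0 \<longrightarrow> ip g p v v > 0))"

definition partial :: "'n \<Rightarrow> (real^'n \<Rightarrow> real) \<Rightarrow> real^'n \<Rightarrow> real" where
  "partial i h p = frechet_derivative h (at p) (axis i 1)"

definition christoffel :: "'n::finite metric \<Rightarrow> real^'n \<Rightarrow> 'n \<Rightarrow> 'n \<Rightarrow> 'n \<Rightarrow> real" where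
  "christoffel g p k i j = (\<Sum>l\<in>UNIV. matrix_inv (g p) $ k $ l / 2 *
     (partial i (\<lambda>q. g q $ j $ l) p + partial j (\<lambda>q. g q $ i $ l) p
        - partial l (\<lambda>q. g q $ i $ j) p))"

definition Gam :: "'n::finite metric \<Rightarrow> real^'n \<Rightarrow> real^'n \<Rightarrow> real^'n \<Rightarrow> real^'n" where
  "Gam g p u v = (\<chi> k. \<Sum>i\<in>UNIV. \<Sum>j\<in>UNIV. christoffel g p k i j * u $ i * v $ j)"

text \<open>The Levi-Civita connection \<open>\<nabla>\<^bsub>X\<^esub> Y\<close>; see \<open>nabla_torsion_free\<close> and \<open>nabla_metric\<close> below.\<close>

definition nabla :: "'n::finite metric \<Rightarrow> 'n vfield \<Rightarrow> 'n vfield \<Rightarrow> 'n vfield" where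
  "nabla g X Y = (\<lambda>p. frechet_derivative Y (at p) (X p) + Gam g p (X p) (Y p))"

definition lie_bracket :: "'n::finite vfield \<Rightarrow> 'n vfield \<Rightarrow> 'n vfield" where
  "lie_bracket X Y =
     (\<lambda>p. frechet_derivative Y (at p) (X p) - frechet_derivative X (at p) (Y p))"

lemma nabla_torsion_free:
  assumes "\<And>p. transpose (g p) = g p"
  shows "nabla g X Y p - nabla g Y X p = lie_bracket X Y p"
proof -
  have sym: "g q $ i $ j = g q $ j $ i" for q i j
    using arg_cong[OF assms[of q], of "\<lambda>A. A $ j $ i"] by (simp add: transpose_def)
  have "christoffel g p k i j = christoffel g p k j i" for k i j
    unfolding christoffel_def sym[of _ i j] by (simp only: add.commute)
  then have c: "christoffel g p k i j * u $ i * v $ j = christoffel g p k j i * v $ j * u $ i"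
    for k i j u v
    by (simp add: mult_ac)
  have "(\<Sum>i\<in>UNIV. \<Sum>j\<in>UNIV. christoffel g p k i j * u $ i * v $ j)
      = (\<Sum>j\<in>UNIV. \<Sum>i\<in>UNIV. christoffel g p k j i * v $ j * u $ i)" for k u v
    by (rule trans[OF sum.swap]) (intro sum.cong refl c)
  then have "Gam g p u v = Gam g p v u" for u v
    by (simp only: Gam_def)
  then show ?thesis
    by (simp add: nabla_def lie_bracket_def)
qed

lemma ip_Gam:
  assumes inv: "invertible (g p)" and sym: "transpose (g p) = g p"
  shows "ip g p (Gam g p u v) w = (\<Sum>i\<in>UNIV. \<Sum>j\<in>UNIV. \<Sum>l\<in>UNIV.
     (partial i (\<lambda>q. g q $ j $ l) p + partial j (\<lambda>q. g q $ i $ l) p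
        - partial l (\<lambda>q. g q $ i $ j) p) / 2 * u $ i * v $ j * w $ l)"
proof -
  define S where "S i j l = (partial i (\<lambda>q. g q $ j $ l) p + partial j (\<lambda>q. g q $ i $ l) p
        - partial l (\<lambda>q. g q $ i $ j) p) / 2" for i j l
  have id: "g p ** matrix_inv (g p) = mat 1"
    using someI_ex[OF inv[unfolded invertible_def]] by (simp add: matrix_inv_def)
  have sy: "(g p *v w) \<bullet> z = w \<bullet> (g p *v z)" for z
    using dot_lmul_matrix[of w "g p" z] vector_transpose_matrix[of w "g p"] by (simp add: sym)
  have G: "Gam g p u v = matrix_inv (g p) *v (\<chi> l. \<Sum>i\<in>UNIV. \<Sum>j\<in>UNIV. S i j l * u $ i * v $ j)"
  proof -
    have "(\<Sum>i\<in>UNIV. \<Sum>j\<in>UNIV. christoffel g p k i j * u $ i * v $ j)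
        = (\<Sum>l\<in>UNIV. matrix_inv (g p) $ k $ l * (\<Sum>i\<in>UNIV. \<Sum>j\<in>UNIV. S i j l * u $ i * v $ j))" for k
    proof -
      have "(\<Sum>i\<in>UNIV. \<Sum>j\<in>UNIV. christoffel g p k i j * u $ i * v $ j)
         = (\<Sum>i\<in>UNIV. \<Sum>j\<in>UNIV. \<Sum>l\<in>UNIV. matrix_inv (g p) $ k $ l * (S i j l * u $ i * v $ j))"
        unfolding christoffel_def S_def sum_distrib_right by (intro sum.cong refl) simp
      also have "\<dots> = (\<Sum>i\<in>UNIV. \<Sum>l\<in>UNIV. \<Sum>j\<in>UNIV. matrix_inv (g p) $ k $ l * (S i j l * u $ i * v $ j))"
        by (rule sum.cong[OF refl], rule sum.swap)
      also have "\<dots> = (\<Sum>l\<in>UNIV. \<Sum>i\<in>UNIV. \<Sum>j\<in>UNIV. matrix_inv (g p) $ k $ l * (S i j l * u $ i * v $ j))"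
        by (rule sum.swap)
      finally show ?thesis by (simp add: sum_distrib_left)
    qed
    then show ?thesis
      by (simp add: Gam_def vec_eq_iff matrix_vector_mult_def)
  qed
  have "ip g p (Gam g p u v) w = w \<bullet> (g p *v Gam g p u v)"
    by (simp only: ip_def inner_commute[of "Gam g p u v"] sy)
  also have "\<dots> = w \<bullet> (\<chi> l. \<Sum>i\<in>UNIV. \<Sum>j\<in>UNIV. S i j l * u $ i * v $ j)"
    by (simp add: G matrix_vector_mul_assoc id)
  also have "\<dots> = (\<Sum>l\<in>UNIV. \<Sum>i\<in>UNIV. \<Sum>j\<in>UNIV. S i j l * u $ i * v $ j * w $ l)"
    by (simp add: inner_vec_def sum_distrib_left mult_ac)
  also have "\<dots> = (\<Sum>i\<in>UNIV. \<Sum>l\<in>UNIV. \<Sum>j\<in>UNIV. S i j l * u $ i * v $ j * w $ l)"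
    by (rule sum.swap)
  also have "\<dots> = (\<Sum>i\<in>UNIV. \<Sum>j\<in>UNIV. \<Sum>l\<in>UNIV. S i j l * u $ i * v $ j * w $ l)"
    by (rule sum.cong[OF refl], rule sum.swap)
  finally show ?thesis by (simp add: S_def)
qed

lemma nabla_metric:
  assumes g: "g differentiable at p" and inv: "invertible (g p)"
    and sym: "\<And>q. transpose (g q) = g q"
    and Y: "Y differentiable at p" and Z: "Z differentiable at p"
  shows "frechet_derivative (\<lambda>q. ip g q (Y q) (Z q)) (at p) (X p)
       = ip g p (nabla g X Y p) (Z p) + ip g p (Y p) (nabla g X Z p)"
proof -
  define G' where "G' = frechet_derivative g (at p)"
  define Y' where "Y' = frechet_derivative Y (at p)"
  define Z' where "Z' = frechet_derivative Z (at p)"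
  have dg: "(g has_derivative G') (at p)" and dY: "(Y has_derivative Y') (at p)"
    and dZ: "(Z has_derivative Z') (at p)"
    using g Y Z unfolding G'_def Y'_def Z'_def by (simp_all flip: frechet_derivative_works)
  have dgij: "((\<lambda>q. g q $ i $ j) has_derivative (\<lambda>u. G' u $ i $ j)) (at p)" for i j
    by (intro derivative_intros bounded_linear.has_derivative[OF bounded_linear_vec_nth] dg)
  have dYi: "((\<lambda>q. Y q $ i) has_derivative (\<lambda>u. Y' u $ i)) (at p)" for i
    by (intro bounded_linear.has_derivative[OF bounded_linear_vec_nth] dY)
  have dZi: "((\<lambda>q. Z q $ i) has_derivative (\<lambda>u. Z' u $ i)) (at p)" for i
    by (intro bounded_linear.has_derivative[OF bounded_linear_vec_nth] dZ)
  have pd: "partial l (\<lambda>q. g q $ i $ j) p = G' (axis l 1) $ i $ j" for l i j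
    unfolding partial_def using frechet_derivative_at[OF dgij] by metis
  have lin: "linear G'" using dg by (rule has_derivative_linear)
  have Gexp: "G' u $ i $ j = (\<Sum>l\<in>UNIV. u $ l * G' (axis l 1) $ i $ j)" for u i j
  proof -
    have "u = (\<Sum>l\<in>UNIV. u $ l *\<^sub>R axis l 1)"
      using basis_expansion[of u] by (simp add: scalar_mult_eq_scaleR)
    then have "G' u = (\<Sum>l\<in>UNIV. u $ l *\<^sub>R G' (axis l 1))"
      by (metis (no_types, lifting) lin linear_sum linear_scale sum.cong)
    then show ?thesis by simp
  qed
  have gs: "g q $ i $ j = g q $ j $ i" for q i j
    using arg_cong[OF sym[of q], of "\<lambda>A. A $ j $ i"] by (simp add: transpose_def)
  have Gs: "G' u $ i $ j = G' u $ j $ i" for u i j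
  proof -
    have "(\<lambda>q. g q $ i $ j) = (\<lambda>q. g q $ j $ i)" using gs by blast
    then show ?thesis
      using has_derivative_unique[OF dgij[of i j]] dgij[of j i] by metis
  qed
  have ipe: "ip g q u v = (\<Sum>i\<in>UNIV. \<Sum>j\<in>UNIV. g q $ i $ j * u $ i * v $ j)" for q u v
    by (simp add: ip_def inner_vec_def matrix_vector_mult_def sum_distrib_left mult_ac)
  have "((\<lambda>q. ip g q (Y q) (Z q)) has_derivative
     (\<lambda>u. \<Sum>i\<in>UNIV. \<Sum>j\<in>UNIV. (g p $ i $ j * Y p $ i) * Z' u $ j
        + (g p $ i $ j * Y' u $ i + G' u $ i $ j * Y p $ i) * Z p $ j)) (at p)"
    unfolding ipe by (intro has_derivative_sum has_derivative_mult dgij dYi dZi)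
  from fun_cong[OF frechet_derivative_at[OF this, symmetric]]
  have L: "frechet_derivative (\<lambda>q. ip g q (Y q) (Z q)) (at p) u
     = ip g p (Y' u) (Z p) + ip g p (Y p) (Z' u)
     + (\<Sum>j\<in>UNIV. \<Sum>l\<in>UNIV. G' u $ j $ l * Y p $ j * Z p $ l)" for u
    unfolding ipe sum.distrib[symmetric]
    by (simp only: ) (intro sum.cong refl, simp add: algebra_simps)
  have ip_add: "ip g p (a + b) c = ip g p a c + ip g p b c"
    "ip g p c (a + b) = ip g p c a + ip g p c b" for a b c
    by (simp_all add: ip_def inner_add_left inner_add_right matrix_vector_right_distrib)
  have ip_sym: "ip g p a b = ip g p b a" for a b
    unfolding ipe by (subst sum.swap) (simp add: gs[of p] mult_ac)
  define D where "D i j l = G' (axis i 1) $ j $ l" for i j l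
  have Ds: "D i j l = D i l j" for i j l
    unfolding D_def by (rule Gs)
  have IG: "ip g p (Gam g p u v) w = (\<Sum>i\<in>UNIV. \<Sum>j\<in>UNIV. \<Sum>l\<in>UNIV.
     (D i j l + D j i l - D l i j) / 2 * u $ i * v $ j * w $ l)" for u v w
    unfolding ip_Gam[of g, OF inv sym] pd D_def ..
  have IG': "ip g p v (Gam g p u w) = (\<Sum>i\<in>UNIV. \<Sum>j\<in>UNIV. \<Sum>l\<in>UNIV.
     (D i l j + D l i j - D j i l) / 2 * u $ i * w $ l * v $ j)" for u v w
    unfolding ip_sym[of v] IG by (rule sum.cong[OF refl], rule sum.swap)
  have K: "ip g p (Gam g p u v) w + ip g p v (Gam g p u w)
      = (\<Sum>j\<in>UNIV. \<Sum>l\<in>UNIV. G' u $ j $ l * v $ j * w $ l)" for u v w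
  proof -
    have "(D i j l + D j i l - D l i j) / 2 * u $ i * v $ j * w $ l
        + (D i l j + D l i j - D j i l) / 2 * u $ i * w $ l * v $ j
        = u $ i * D i j l * v $ j * w $ l" for i j l
      unfolding Ds[of i l j] by (simp add: field_simps)
    then have "ip g p (Gam g p u v) w + ip g p v (Gam g p u w)
      = (\<Sum>i\<in>UNIV. \<Sum>j\<in>UNIV. \<Sum>l\<in>UNIV. u $ i * D i j l * v $ j * w $ l)"
      unfolding IG IG' sum.distrib[symmetric] by simp
    also have "\<dots> = (\<Sum>j\<in>UNIV. \<Sum>i\<in>UNIV. \<Sum>l\<in>UNIV. u $ i * D i j l * v $ j * w $ l)"
      by (rule sum.swap)
    also have "\<dots> = (\<Sum>j\<in>UNIV. \<Sum>l\<in>UNIV. \<Sum>i\<in>UNIV. u $ i * D i j l * v $ j * w $ l)"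
      by (rule sum.cong[OF refl], rule sum.swap)
    finally show ?thesis
      by (simp add: Gexp[of u] D_def sum_distrib_right)
  qed
  show ?thesis
    using K[of "X p" "Y p" "Z p"] by (simp add: L nabla_def ip_add flip: Y'_def Z'_def)
qed


section \<open>Curvature and its covariant derivatives\<close>

definition curv_operator ::
  "'n::finite metric \<Rightarrow> 'n vfield \<Rightarrow> 'n vfield \<Rightarrow> 'n vfield \<Rightarrow> 'n vfield" where
  "curv_operator g X Y Z = (\<lambda>p. nabla g X (nabla g Y Z) p - nabla g Y (nabla g X Z) p
     - nabla g (lie_bracket X Y) Z p)"

text \<open>Tensor fields of type \<open>(0,r)\<close> and \<open>(1,r)\<close> are functions of a point and a list of tangent
  vectors at that point; only lists of length \<open>r\<close> are meaningful. They are evaluated, and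
  differentiated, on the vector fields with constant coefficients extending the given tangent
  vectors.\<close>

type_synonym 'n tensor = "real^'n \<Rightarrow> (real^'n) list \<Rightarrow> real"
type_synonym 'n vtensor = "real^'n \<Rightarrow> (real^'n) list \<Rightarrow> real^'n"

definition curv_op_tensor :: "'n::finite metric \<Rightarrow> 'n vtensor" where
  "curv_op_tensor g p vs =
     curv_operator g (\<lambda>_. vs ! 0) (\<lambda>_. vs ! 1) (\<lambda>_. vs ! 2) p"

definition curv_tensor :: "'n::finite metric \<Rightarrow> 'n tensor" where
  "curv_tensor g p vs =
     ip g p (curv_operator g (\<lambda>_. vs ! 0) (\<lambda>_. vs ! 1) (\<lambda>_. vs ! 2) p) (vs ! 3)"

text \<open>\<open>(\<nabla>T)(v\<^sub>1, \<dots>, v\<^sub>r, u) = (\<nabla>\<^sub>u T)(v\<^sub>1, \<dots>, v\<^sub>r)\<close>: the direction of differentiation is the last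
  argument. For a constant field \<open>w\<close> one has \<open>\<nabla>\<^sub>u w = Gam g p u w\<close>.\<close>

definition cov_deriv :: "'n::finite metric \<Rightarrow> 'n tensor \<Rightarrow> 'n tensor" where
  "cov_deriv g T p vs = (let u = last vs; ws = butlast vs in
     frechet_derivative (\<lambda>q. T q ws) (at p) u
     - (\<Sum>i<length ws. T p (ws[i := nabla g (\<lambda>_. u) (\<lambda>_. ws ! i) p])))"

definition cov_deriv_vec :: "'n::finite metric \<Rightarrow> 'n vtensor \<Rightarrow> 'n vtensor" where
  "cov_deriv_vec g T p vs = (let u = last vs; ws = butlast vs in
     nabla g (\<lambda>_. u) (\<lambda>q. T q ws) p
     - (\<Sum>i<length ws. T p (ws[i := nabla g (\<lambda>_. u) (\<lambda>_. ws ! i) p])))"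

definition nabla_R :: "'n::finite metric \<Rightarrow> nat \<Rightarrow> 'n tensor" where
  "nabla_R g k = (cov_deriv g ^^ k) (curv_tensor g)"

definition nabla_R_op :: "'n::finite metric \<Rightarrow> nat \<Rightarrow> 'n vtensor" where
  "nabla_R_op g k = (cov_deriv_vec g ^^ k) (curv_op_tensor g)"


section \<open>Scalar Weyl invariants\<close>

text \<open>\<open>nabla_R_prod g [k\<^sub>1, \<dots>, k\<^sub>m]\<close> is the tensor product of the \<open>\<nabla>\<^bsup>k\<^esup>R\<close> for \<open>k = k\<^sub>1, \<dots>, k\<^sub>m\<close>, of
  rank \<open>(4 + k\<^sub>1) + \<dots> + (4 + k\<^sub>m)\<close>.\<close>

fun nabla_R_prod :: "'n::finite metric \<Rightarrow> nat list \<Rightarrow> 'n tensor" where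
  "nabla_R_prod g [] p vs = 1"
| "nabla_R_prod g (k # ks) p vs =
     nabla_R g k p (take (4 + k) vs) * nabla_R_prod g ks p (drop (4 + k) vs)"

text \<open>A partition of the \<open>r\<close> index positions into pairs, given as a fixed point free involution.\<close>

definition pairing :: "nat \<Rightarrow> (nat \<Rightarrow> nat) \<Rightarrow> bool" where
  "pairing r \<sigma> \<longleftrightarrow> (\<forall>i<r. \<sigma> i < r \<and> \<sigma> i \<noteq> i \<and> \<sigma> (\<sigma> i) = i)"

definition full_contraction ::
  "'n::finite metric \<Rightarrow> nat \<Rightarrow> (nat \<Rightarrow> nat) \<Rightarrow> 'n tensor \<Rightarrow> real^'n \<Rightarrow> real" where
  "full_contraction g r \<sigma> T p = (\<Sum>a\<in>{a :: 'n list. length a = r}.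
     (\<Prod>i\<in>{i. i < r \<and> i < \<sigma> i}. matrix_inv (g p) $ (a ! i) $ (a ! \<sigma> i))
       * T p (map (\<lambda>i. axis i 1) a))"

inductive scalar_weyl_invariant :: "'n::finite metric \<Rightarrow> (real^'n \<Rightarrow> real) \<Rightarrow> bool"
  for g :: "'n metric" where
  contraction: "\<lbrakk>ks \<noteq> []; r = (\<Sum>k\<leftarrow>ks. 4 + k); pairing r \<sigma>\<rbrakk>
     \<Longrightarrow> scalar_weyl_invariant g (full_contraction g r \<sigma> (nabla_R_prod g ks))"
| add: "\<lbrakk>scalar_weyl_invariant g I; scalar_weyl_invariant g J\<rbrakk>
     \<Longrightarrow> scalar_weyl_invariant g (\<lambda>p. I p + J p)"
| scale: "scalar_weyl_invariant g I \<Longrightarrow> scalar_weyl_invariant g (\<lambda>p. c * I p)"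


section \<open>Symmetry and indecomposability\<close>

definition local_symmetric :: "'n::finite metric \<Rightarrow> bool" where
  "local_symmetric g \<longleftrightarrow> (\<forall>p vs. length vs = 5 \<longrightarrow> nabla_R g 1 p vs = 0)"

definition multilinear_on ::
  "'a::real_vector set \<Rightarrow> nat \<Rightarrow> ('a list \<Rightarrow> real) \<Rightarrow> bool" where
  "multilinear_on V r T \<longleftrightarrow> (\<forall>vs i. length vs = r \<and> set vs \<subseteq> V \<and> i < r \<longrightarrow>
     (\<forall>u\<in>V. \<forall>w\<in>V. \<forall>a b.
        T (vs[i := a *\<^sub>R u + b *\<^sub>R w]) = a * T (vs[i := u]) + b * T (vs[i := w])))"

definition decomposable_at :: "'n::finite metric \<Rightarrow> real^'n \<Rightarrow> bool" where
  "decomposable_at g p \<longleftrightarrow> (\<exists>V1 V2.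
     subspace V1 \<and> subspace V2 \<and> V1 \<noteq> {0} \<and> V2 \<noteq> {0} \<and>
     V1 \<inter> V2 = {0} \<and> (\<forall>v. \<exists>v1\<in>V1. \<exists>v2\<in>V2. v = v1 + v2) \<and>
     (\<forall>v1\<in>V1. \<forall>v2\<in>V2. ip g p v1 v2 = 0) \<and>
     (\<exists>R1 R2. multilinear_on V1 4 R1 \<and> multilinear_on V2 4 R2 \<and>
        (\<forall>vs ws. length vs = 4 \<and> length ws = 4 \<and> set vs \<subseteq> V1 \<and> set ws \<subseteq> V2 \<longrightarrow>
           curv_tensor g p (map2 (+) vs ws) = R1 vs + R2 ws)))"

definition indecomposable :: "'n::finite metric \<Rightarrow> bool" where
  "indecomposable g \<longleftrightarrow> (\<forall>p. \<not> decomposable_at g p)"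


section \<open>Homogeneity\<close>

definition isometry_between ::
  "'n::finite metric \<Rightarrow> 'n metric \<Rightarrow> (real^'n) set \<Rightarrow> (real^'n) set \<Rightarrow> (real^'n \<Rightarrow> real^'n) \<Rightarrow> bool"
  where
  "isometry_between g h U V \<Phi> \<longleftrightarrow>
     bij_betw \<Phi> U V \<and> smooth_on U \<Phi> \<and> smooth_on V (inv_into U \<Phi>) \<and>
     (\<forall>p\<in>U. \<forall>u v. ip h (\<Phi> p) (frechet_derivative \<Phi> (at p) u) (frechet_derivative \<Phi> (at p) v)
        = ip g p u v)"

definition locally_homogeneous :: "'n::finite metric \<Rightarrow> bool" where
  "locally_homogeneous g \<longleftrightarrow> (\<forall>P Q. \<exists>U V \<Phi>. open U \<and> P \<in> U \<and> open V \<and> Q \<in> V \<and>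
     isometry_between g g U V \<Phi> \<and> \<Phi> P = Q)"

text \<open>Linear isometries \<open>(\<real>\<^sup>n, g\<^sub>P) \<rightarrow> (\<real>\<^sup>n, h\<^sub>Q)\<close>\<close>

definition linear_isometry ::
  "'n::finite metric \<Rightarrow> real^'n \<Rightarrow> 'n metric \<Rightarrow> real^'n \<Rightarrow> (real^'n \<Rightarrow> real^'n) \<Rightarrow> bool" where
  "linear_isometry g P h Q \<phi> \<longleftrightarrow>
     linear \<phi> \<and> bij \<phi> \<and> (\<forall>u v. ip h Q (\<phi> u) (\<phi> v) = ip g P u v)"

definition curvature_homogeneous :: "nat \<Rightarrow> 'n::finite metric \<Rightarrow> bool" where
  "curvature_homogeneous k g \<longleftrightarrow> (\<forall>P Q. \<exists>\<phi>. linear_isometry g P g Q \<phi> \<and>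
     (\<forall>i\<le>k. \<forall>vs. length vs = 4 + i \<longrightarrow> nabla_R g i Q (map \<phi> vs) = nabla_R g i P vs))"

definition affine_curvature_homogeneous :: "nat \<Rightarrow> 'n::finite metric \<Rightarrow> bool" where
  "affine_curvature_homogeneous k g \<longleftrightarrow> (\<forall>P Q. \<exists>\<phi>. linear \<phi> \<and> bij \<phi> \<and>
     (\<forall>i\<le>k. \<forall>vs. length vs = 3 + i \<longrightarrow>
        inv \<phi> (nabla_R_op g i Q (map \<phi> vs)) = nabla_R_op g i P vs))"

definition zero_curvature_modeled_on :: "'n::finite metric \<Rightarrow> 'n metric \<Rightarrow> bool" where
  "zero_curvature_modeled_on g h \<longleftrightarrow> (\<forall>P Q. \<exists>\<phi>. linear_isometry g P h Q \<phi> \<and>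
     (\<forall>vs. length vs = 4 \<longrightarrow> curv_tensor h Q (map \<phi> vs) = curv_tensor g P vs))"


section \<open>The manifolds \<open>M\<^sub>f\<close> and \<open>S\<^sub>\<epsilon>\<close>\<close>

text \<open>The coordinates \<open>(x, y, x\<^sup>~)\<close> have the indices \<open>1, 2, 3\<close>.\<close>

definition metric_M :: "(real \<Rightarrow> real) \<Rightarrow> 3 metric" where
  "metric_M f p = vector [vector [- 2 * f (p $ 2), 0, 1],
                          vector [0, 1, 0],
                          vector [1, 0, 0]]"

lemma Ck_on_lift:
  fixes h :: "real \<Rightarrow> real" and C E :: "real^3^3"
  assumes "Ck_on k UNIV h"
  shows "Ck_on k UNIV (\<lambda>p::real^3. C + h (p $ 2) *\<^sub>R E)"
  using assms
proof (induction k arbitrary: h C E)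
  case 0
  then show ?case
    by (auto intro!: continuous_intros continuous_on_compose2[of UNIV h])
next
  case (Suc k)
  define h' where "h' y = frechet_derivative h (at y) 1" for y
  have dh: "(h has_real_derivative h' y) (at y)" for y
  proof -
    have d: "(h has_derivative frechet_derivative h (at y)) (at y)"
      using Suc.prems by (simp flip: frechet_derivative_works)
    have "frechet_derivative h (at y) t = h' y * t" for t
      using linear_scale[OF has_derivative_linear[OF d], of t 1] by (simp add: h'_def)
    then have "frechet_derivative h (at y) = (*) (h' y)"
      by blast
    then show ?thesis
      using d by (simp add: has_field_derivative_def)
  qed
  have d: "((\<lambda>p::real^3. C + h (p $ 2) *\<^sub>R E) has_derivative
      (\<lambda>v. 0 + (h' (p $ 2) * v $ 2) *\<^sub>R E)) (at p)" for p
  proof -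
    have "((\<lambda>p::real^3. h (p $ 2)) has_derivative (\<lambda>v. h' (p $ 2) * v $ 2)) (at p)"
      by (rule has_derivative_compose[OF bounded_linear_imp_has_derivative[OF bounded_linear_vec_nth]
            dh[unfolded has_field_derivative_def]])
    then show ?thesis
      by (intro has_derivative_add has_derivative_const has_derivative_scaleR_left)
  qed
  have "frechet_derivative (\<lambda>p::real^3. C + h (p $ 2) *\<^sub>R E) (at p) v
      = 0 + h' (p $ 2) *\<^sub>R (v $ 2 *\<^sub>R E)" for p v
    using fun_cong[OF frechet_derivative_at[OF d, symmetric]] by simp
  moreover have "Ck_on k UNIV h'"
    using Suc.prems unfolding h'_def[abs_def] by simp
  ultimately have "\<forall>v. Ck_on k UNIV
      (\<lambda>p. frechet_derivative (\<lambda>p::real^3. C + h (p $ 2) *\<^sub>R E) (at p) v)"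
    using Suc.IH[of h' 0] by (simp only: simp_thms)
  then show ?case
    using d unfolding Ck_on.simps differentiable_def by blast
qed

lemma lorentzian_metric_M:
  assumes "smooth_on UNIV f"
  shows "lorentzian (metric_M f)"
proof -
  have M: "metric_M f = (\<lambda>p. vector [vector [0, 0, 1], vector [0, 1, 0], vector [1, 0, 0]]
      + f (p $ 2) *\<^sub>R vector [vector [- 2, 0, 0], vector [0, 0, 0], vector [0, 0, 0]])"
    by (simp add: fun_eq_iff metric_M_def vec_eq_iff forall_3)
  have ip: "ip (metric_M f) p u v = - 2 * f (p $ 2) * u $ 1 * v $ 1 + u $ 1 * v $ 3
      + u $ 3 * v $ 1 + u $ 2 * v $ 2" for p u v
    by (simp add: ip_def metric_M_def inner_vec_def matrix_vector_mult_def sum_3 algebra_simps)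
  have "\<exists>u. ip (metric_M f) p u u < 0 \<and>
      (\<forall>v. v \<noteq> 0 \<and> ip (metric_M f) p u v = 0 \<longrightarrow> ip (metric_M f) p v v > 0)" for p
  proof (intro exI[of _ "vector [1, 0, f (p $ 2) - 1]"] conjI allI impI)
    fix v :: "real^3"
    assume v: "v \<noteq> 0 \<and> ip (metric_M f) p (vector [1, 0, f (p $ 2) - 1]) v = 0"
    then have v3: "v $ 3 = (f (p $ 2) + 1) * v $ 1"
      by (simp add: ip algebra_simps)
    then have "v $ 1 \<noteq> 0 \<or> v $ 2 \<noteq> 0"
      using v by (auto simp: vec_eq_iff forall_3)
    then have "0 < (v $ 1)\<^sup>2 + (v $ 2)\<^sup>2"
      by (simp only: sum_power2_gt_zero_iff)
    then have "0 < (v $ 1)\<^sup>2 + ((v $ 1)\<^sup>2 + (v $ 2)\<^sup>2)"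
      by (rule add_nonneg_pos[OF zero_le_power2])
    then show "ip (metric_M f) p v v > 0"
      by (simp add: ip v3 algebra_simps power2_eq_square)
  qed (simp add: ip)
  moreover have "transpose (metric_M f p) = metric_M f p" for p
    by (simp add: metric_M_def transpose_def vec_eq_iff forall_3)
  moreover have "smooth_on UNIV (metric_M f)"
    using assms unfolding smooth_on_def M by (blast intro: Ck_on_lift)
  ultimately show ?thesis
    by (simp add: lorentzian_def)
qed

definition metric_S :: "real \<Rightarrow> 3 metric" where
  "metric_S \<epsilon> = metric_M (\<lambda>y. \<epsilon> * y\<^sup>2 / 2)"

end

theory Submission
  imports Defs
begin

text \<open>
  Put \<open>F = f''\<close>, regarded as a function on the manifold, and let \<open>\<omega> = dx \<and> dy\<close> (here \<open>area\<close>),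
  with \<open>J\<close> (here \<open>area_op\<close>) the endomorphism obtained from it by raising an index. Everything
  rests on one observation: \<open>\<omega>\<close> and \<open>J\<close> are parallel, and the curvature is \<open>F \<omega> \<otimes> J\<close> as an
  operator and \<open>- F \<omega> \<otimes> \<omega>\<close> as a tensor. Hence the \<open>k\<close>-th covariant derivative of the curvature
  is obtained by replacing \<open>F\<close> with \<open>\<nabla>\<^sup>kF\<close> (\<open>nabla_R_metric_M\<close>, \<open>nabla_R_op_metric_M\<close>). The
  tensors \<open>\<nabla>\<^sup>kF\<close> annihilate the null vector \<open>e3\<close> (the coordinate field of the third coordinate),
  and \<open>\<nabla>F = f''' dy\<close>, \<open>\<nabla>\<^sup>2F = f'''' dy\<^sup>2 - f' f''' dx\<^sup>2\<close>.

  Weyl invariants. The inverse metric pairs \<open>x\<close> only with the third coordinate, which the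
  curvature does not see. So a contraction involves only terms with all indices equal to \<open>y\<close>,
  where \<open>\<omega>\<close> vanishes.

  Symmetric spaces. For \<open>f = \<epsilon> y\<^sup>2 / 2\<close> the function \<open>F\<close> is constant, so \<open>\<nabla>R = 0\<close>. In an
  orthogonal splitting of the curvature \<open>\<omega>\<close> would vanish on the summands and between them, so it
  would be zero.

  Necessary conditions. A linear isomorphism that respects the curvature operators at \<open>P\<close> and
  \<open>Q\<close> intertwines \<open>J\<close> up to a scalar and is therefore triangular, with diagonal entries \<open>\<alpha>\<close> and
  \<open>\<beta>\<close> for \<open>x\<close> and \<open>y\<close> and with \<open>F(P) = \<alpha>\<^sup>2 F(Q)\<close> (\<open>affine_curvature_map\<close>). Order one adds
  \<open>f'''(P) = \<alpha>\<^sup>2 \<beta> f'''(Q)\<close>, which can be solved for \<open>\<beta>\<close>; for an isometry \<open>\<beta> = \<plusminus>1\<close>, and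
  \<open>f''' / f''\<close> must be constant. Order two adds \<open>(f' f''')(P) = \<alpha>\<^sup>4 (f' f''')(Q)\<close>, so
  \<open>f' f''' / f''\<^sup>2\<close> is an affine invariant; if it is constant, then \<open>f'\<close> is exponential
  (\<open>ratio_const_imp_exp\<close>).

  Sufficient conditions. At order zero the only requirement is the equation for \<open>\<alpha>\<close>, so the sign
  of \<open>f''\<close> decides; the metric is adjusted afterwards by adding a multiple of \<open>e3\<close> to the image
  of \<open>e1\<close>. At order one, \<open>\<alpha>\<close> and \<open>\<beta>\<close> solve both equations if \<open>\<beta>\<close> is unrestricted. If \<open>f'\<close> is
  exponential, then a translation in \<open>y\<close> multiplies it by a constant, and explicit affine maps
  are global isometries that act transitively (\<open>locally_homogeneous_of_exp\<close>); their linear parts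
  preserve all \<open>\<nabla>\<^sup>kR\<close> (\<open>curvature_homogeneous_of_exp\<close>).

  Local isometries. That local homogeneity makes \<open>f'\<close> exponential is derived from the
  transformation law of the connection (\<open>isometry_second_derivative\<close>): the symmetry of the
  second derivatives of the Jacobian entries leads to relations between \<open>f'\<close>, \<open>f''\<close>, \<open>f'''\<close> at a
  point and at its image (\<open>local_isometry_invariants\<close>) that make the same ratio invariant.
\<close>

section \<open>The coordinate frame and functions of \<open>y\<close>\<close>

text \<open>The coordinate fields of \<open>x\<close>, \<open>y\<close> and the third coordinate; \<open>e3\<close> is null and parallel.\<close>

abbreviation e1 :: "real^3" where "e1 \<equiv> axis 1 1"
abbreviation e2 :: "real^3" where "e2 \<equiv> axis 2 1"
abbreviation e3 :: "real^3" where "e3 \<equiv> axis 3 1"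

lemma axis_nth_3 [simp]:
  "e1 $ 1 = 1" "e1 $ 2 = 0" "e1 $ 3 = 0"
  "e2 $ 1 = 0" "e2 $ 2 = 1" "e2 $ 3 = 0"
  "e3 $ 1 = 0" "e3 $ 2 = 0" "e3 $ 3 = 1"
  by (simp_all add: axis_def)

lemma has_derivative_profile:
  assumes "(h has_real_derivative h') (at (p $ 2))"
  shows "((\<lambda>q::real^3. h (q $ 2)) has_derivative (\<lambda>v. h' * v $ 2)) (at p)"
  by (rule has_derivative_compose[OF bounded_linear_imp_has_derivative[OF bounded_linear_vec_nth]
        assms[unfolded has_field_derivative_def]])

lemma deriv_smooth:
  fixes f :: "real \<Rightarrow> real"
  assumes "smooth_on UNIV f"
  shows "(f has_real_derivative deriv f y) (at y)" and "smooth_on UNIV (deriv f)"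
proof -
  have d: "f differentiable at y" for y
    using assms unfolding smooth_on_def by (metis Ck_on.simps(2) UNIV_I)
  then show D: "(f has_real_derivative deriv f y) (at y)" for y
    using DERIV_deriv_iff_real_differentiable by blast
  have "frechet_derivative f (at y) 1 = deriv f y" for y
    using fun_cong[OF frechet_derivative_at[OF D[of y, unfolded has_field_derivative_def]], of 1]
    by simp
  then have "(\<lambda>y. frechet_derivative f (at y) 1) = deriv f"
    by blast
  then show "smooth_on UNIV (deriv f)"
    using assms unfolding smooth_on_def by (metis Ck_on.simps(2))
qed

lemma smooth_deriv_funpow:
  fixes f :: "real \<Rightarrow> real"
  assumes "smooth_on UNIV f"
  shows "smooth_on UNIV ((deriv ^^ n) f)"
proof (induction n)
  case (Suc n)
  then show ?case using deriv_smooth(2) by simp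
qed (simp add: assms)

lemma deriv_funpow:
  fixes f :: "real \<Rightarrow> real"
  assumes "smooth_on UNIV f"
  shows "((deriv ^^ n) f has_real_derivative (deriv ^^ Suc n) f y) (at y)"
  using deriv_smooth(1)[OF smooth_deriv_funpow[OF assms, of n]] by simp

lemma deriv_1_smooth:
  fixes f :: "real \<Rightarrow> real"
  assumes "smooth_on UNIV f"
  shows "(deriv f has_real_derivative (deriv ^^ 2) f y) (at y)"
  using deriv_funpow[OF assms, of 1 y] by (simp add: numeral_2_eq_2)

lemma deriv_2_smooth:
  fixes f :: "real \<Rightarrow> real"
  assumes "smooth_on UNIV f"
  shows "((deriv ^^ 2) f has_real_derivative (deriv ^^ 3) f y) (at y)"
  using deriv_funpow[OF assms, of 2 y] by (simp add: eval_nat_numeral)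

section \<open>Two characterisations of exponential functions\<close>

lemma nonvanishing_sgn_const:
  fixes h :: "real \<Rightarrow> real"
  assumes "\<And>y. isCont h y" and "\<And>y. h y \<noteq> 0"
  shows "sgn (h x) = sgn (h y)"
proof (rule ccontr)
  assume n: "sgn (h x) \<noteq> sgn (h y)"
  have "connected (range h)"
    using assms(1) by (intro connected_continuous_image) (auto intro: continuous_at_imp_continuous_on)
  moreover have "h x < 0 \<and> 0 < h y \<or> h y < 0 \<and> 0 < h x"
    using n assms(2)[of x] assms(2)[of y] by (auto simp: sgn_if split: if_splits)
  ultimately have "0 \<in> range h"
    by (meson connectedD_interval less_imp_le rangeI)
  then show False
    using assms(2) by (metis imageE)
qed

lemma exp_ode:
  fixes h :: "real \<Rightarrow> real"
  assumes "\<And>y. (h has_real_derivative b * h y) (at y)"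
  shows "h y = h 0 * exp (b * y)"
proof -
  have "((\<lambda>y. h y * exp (- b * y)) has_real_derivative 0) (at y)" for y
    by (auto intro!: derivative_eq_intros assms simp: algebra_simps)
  then have "h y * exp (- b * y) = h 0 * exp (- b * 0)"
    by (rule DERIV_isconst_all[rule_format]) 
  then show ?thesis
    by (simp add: exp_minus field_simps)
qed

text \<open>Only squares are compared because an isometry may reverse the direction of \<open>\<partial>\<^sub>y\<close>; the
  quotient has constant sign, hence is itself constant.\<close>

lemma third_over_second_const_imp_exp:
  fixes f :: "real \<Rightarrow> real"
  assumes f: "smooth_on UNIV f"
    and F: "\<And>y. (deriv ^^ 2) f y \<noteq> 0" "\<And>y. (deriv ^^ 3) f y \<noteq> 0"
    and sq: "\<And>x y. ((deriv ^^ 3) f x / (deriv ^^ 2) f x)\<^sup>2 = ((deriv ^^ 3) f y / (deriv ^^ 2) f y)\<^sup>2"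
  shows "\<exists>a b. \<forall>y. (deriv ^^ 2) f y = a * exp (b * y)"
proof -
  define r where "r y = (deriv ^^ 3) f y / (deriv ^^ 2) f y" for y
  have c: "isCont ((deriv ^^ n) f) y" for n y
    using DERIV_isCont[OF deriv_funpow[OF f]] .
  have "sgn (r x) = sgn (r y)" for x y
    by (rule nonvanishing_sgn_const) (auto simp: r_def F intro!: continuous_intros c)
  moreover have "\<bar>r x\<bar> = \<bar>r y\<bar>" for x y
    using sq[of x y] unfolding r_def[symmetric] by (simp add: power2_eq_iff abs_eq_iff)
  ultimately have r: "r y = r 0" for y
    by (metis sgn_mult_abs)
  have "(deriv ^^ 3) f y = r y * (deriv ^^ 2) f y" for y
    using F(1)[of y] by (simp add: r_def)
  then have "((deriv ^^ 2) f has_real_derivative r 0 * (deriv ^^ 2) f y) (at y)" for y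
    using deriv_2_smooth[OF f, of y] r[of y] by metis
  from exp_ode[OF this] show ?thesis
    by blast
qed

text \<open>If the ratio is the constant \<open>\<kappa>\<close>, then \<open>f' / f''\<close> has derivative \<open>1 - \<kappa>\<close> and is an affine
  function. It has no zero: \<open>\<kappa> = 0\<close> would mean \<open>f' = 0\<close>, so \<open>\<kappa>\<close> and \<open>f'\<close> are nonzero. Hence
  \<open>f' / f''\<close> is constant. It is essential that \<open>f\<close> is defined on the whole line, for on a
  half-line powers of \<open>y\<close> have constant ratio as well.\<close>

lemma ratio_const_imp_exp:
  fixes f :: "real \<Rightarrow> real"
  assumes f: "smooth_on UNIV f"
    and F: "\<And>y. (deriv ^^ 2) f y \<noteq> 0" "\<And>y. (deriv ^^ 3) f y \<noteq> 0"
    and G: "\<And>x y. deriv f x * (deriv ^^ 3) f x / ((deriv ^^ 2) f x)\<^sup>2 =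
      deriv f y * (deriv ^^ 3) f y / ((deriv ^^ 2) f y)\<^sup>2"
  shows "\<exists>a b. \<forall>y. deriv f y = a * exp (b * y)"
proof -
  define \<kappa> where "\<kappa> = deriv f 0 * (deriv ^^ 3) f 0 / ((deriv ^^ 2) f 0)\<^sup>2"
  have d1: "(deriv f has_real_derivative (deriv ^^ 2) f y) (at y)" for y
    by (rule deriv_1_smooth[OF f])
  have d2: "((deriv ^^ 2) f has_real_derivative (deriv ^^ 3) f y) (at y)" for y
    by (rule deriv_2_smooth[OF f])
  have \<kappa>: "deriv f y * (deriv ^^ 3) f y / ((deriv ^^ 2) f y)\<^sup>2 = \<kappa>" for y
    using G[of y 0] by (simp add: \<kappa>_def)
  have "\<kappa> \<noteq> 0"
  proof
    assume "\<kappa> = 0"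
    then have "deriv f y = 0" for y
      using \<kappa>[of y] F by simp
    then have "(deriv ^^ 2) f 0 = 0"
      using DERIV_unique[OF d1[of 0], of 0] by (simp add: ext[of "deriv f" "\<lambda>_. 0"])
    then show False
      using F(1) by blast
  qed
  then have n: "deriv f y \<noteq> 0" for y
    using \<kappa>[of y] by auto
  define w where "w y = deriv f y / (deriv ^^ 2) f y" for y
  have "((deriv ^^ 2) f y * (deriv ^^ 2) f y - deriv f y * (deriv ^^ 3) f y)
      / ((deriv ^^ 2) f y * (deriv ^^ 2) f y) = 1 - \<kappa>" for y
    using F(1)[of y] unfolding \<kappa>[of y, symmetric] by (simp add: field_simps power2_eq_square)
  then have dw: "(w has_real_derivative 1 - \<kappa>) (at y)" for y
    using DERIV_divide[OF d1 d2, of y] F(1) unfolding w_def by simp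
  have "((\<lambda>y. w y - (1 - \<kappa>) * y) has_real_derivative 0) (at y)" for y
    by (auto intro!: derivative_eq_intros dw)
  then have w: "w y - (1 - \<kappa>) * y = w 0 - (1 - \<kappa>) * 0" for y
    by (rule DERIV_isconst_all[rule_format])
  \<comment> \<open>Otherwise the affine function \<open>w\<close> would have a zero, and so would \<open>f'\<close>.\<close>
  have "\<kappa> = 1"
  proof (rule ccontr)
    assume "\<kappa> \<noteq> 1"
    then have "w (- w 0 / (1 - \<kappa>)) = 0"
      using w[of "- w 0 / (1 - \<kappa>)"] by (simp add: field_simps)
    then show False
      using n F(1) by (simp add: w_def)
  qed
  then have e: "deriv f y / (deriv ^^ 2) f y = w 0" for y
    using w[of y] by (simp add: w_def)
  have "(deriv ^^ 2) f y = (1 / w 0) * deriv f y" for y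
    using n[of y] F(1)[of y] by (auto simp flip: e[of y])
  then have "(deriv f has_real_derivative (1 / w 0) * deriv f y) (at y)" for y
    using d1[of y] by metis
  from exp_ode[OF this] show ?thesis
    by blast
qed

section \<open>Connection and curvature\<close>

lemma ip_metric_M:
  "ip (metric_M f) p u v =
     - 2 * f (p $ 2) * u $ 1 * v $ 1 + u $ 1 * v $ 3 + u $ 3 * v $ 1 + u $ 2 * v $ 2"
  by (simp add: ip_def metric_M_def inner_vec_def matrix_vector_mult_def sum_3 algebra_simps)

lemma ip_metric_M_nondegenerate:
  assumes "\<And>z. ip (metric_M f) p x z = ip (metric_M f) p y z"
  shows "x = y"
  using assms[of e1] assms[of e2] assms[of e3] by (auto simp: ip_metric_M vec_eq_iff forall_3)

lemma matrix_inv_eqI: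
  fixes A B :: "real^'n^'n"
  assumes AB: "A ** B = mat 1" and BA: "B ** A = mat 1"
  shows "matrix_inv A = B"
proof -
  from someI[of "\<lambda>X. A ** X = mat 1 \<and> X ** A = mat 1", OF conjI[OF AB BA]]
  have "A ** matrix_inv A = mat 1"
    unfolding matrix_inv_def by (rule conjunct1)
  then have "B ** (A ** matrix_inv A) = B"
    by simp
  then show ?thesis
    by (simp add: matrix_mul_assoc BA)
qed

lemma matrix_inv_metric_M:
  "matrix_inv (metric_M f p) = vector [vector [0, 0, 1], vector [0, 1, 0], vector [1, 0, 2 * f (p $ 2)]]"
  by (rule matrix_inv_eqI)
    (simp_all add: metric_M_def vec_eq_iff matrix_matrix_mult_def forall_3 sum_3 mat_def)

lemma partial_metric_M:
  assumes "smooth_on UNIV f"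
  shows "partial l (\<lambda>q. metric_M f q $ i $ j) p =
    (if i = 1 \<and> j = 1 \<and> l = 2 then - 2 * deriv f (p $ 2) else 0)"
proof -
  have c: "((\<lambda>q. metric_M f q $ 1 $ 1) has_derivative (\<lambda>v. - 2 * (deriv f (p $ 2) * v $ 2))) (at p)"
    unfolding metric_M_def
    by (simp, intro has_derivative_mult_right has_derivative_minus has_derivative_profile
          deriv_smooth(1)[OF assms])
  show ?thesis
  proof (cases "i = 1 \<and> j = 1")
    case True
    then show ?thesis
      using fun_cong[OF frechet_derivative_at[OF c]] exhaust_3[of l]
      by (auto simp: partial_def simp flip: frechet_derivative_at[OF c])
  next
    case False
    then have "(\<lambda>q. metric_M f q $ i $ j) = (\<lambda>q. metric_M f 0 $ i $ j)"
      using exhaust_3[of i] exhaust_3[of j] by (auto simp: metric_M_def)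
    then have "((\<lambda>q. metric_M f q $ i $ j) has_derivative (\<lambda>v. 0)) (at p)"
      by simp
    then show ?thesis
      using False by (auto simp: partial_def simp flip: frechet_derivative_at)
  qed
qed

lemma Gam_metric_M:
  assumes "smooth_on UNIV f"
  shows "Gam (metric_M f) p u v =
    deriv f (p $ 2) *\<^sub>R vector [0, u $ 1 * v $ 1, - (u $ 1 * v $ 2 + u $ 2 * v $ 1)]"
  by (simp add: Gam_def christoffel_def matrix_inv_metric_M partial_metric_M[OF assms]
      vec_eq_iff forall_3 sum_3 algebra_simps)

lemma Gam_zero_left:
  assumes "smooth_on UNIV f"
  shows "Gam (metric_M f) p 0 v = 0"
  by (simp add: Gam_metric_M[OF assms] vec_eq_iff forall_3)

lemma nabla_const:
  "nabla g (\<lambda>_. u) (\<lambda>_. w) p = Gam g p u w"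
  by (simp add: nabla_def)

text \<open>The two-form \<open>dx \<and> dy\<close>.\<close>

definition area :: "real^3 \<Rightarrow> real^3 \<Rightarrow> real" where
  "area u v = u $ 1 * v $ 2 - u $ 2 * v $ 1"

text \<open>The area form with an index raised: \<open>g(area_op v, w) = - area v w\<close>. It is nilpotent and
  maps \<open>\<partial>\<^sub>x\<close> to \<open>- \<partial>\<^sub>y\<close>, \<open>\<partial>\<^sub>y\<close> to the null vector \<open>e3\<close> and \<open>e3\<close> to \<open>0\<close>.\<close>

definition area_op :: "real^3 \<Rightarrow> real^3" where
  "area_op v = vector [0, - v $ 1, v $ 2]"

lemma area_op_nth [simp]:
  "area_op v $ 1 = 0" "area_op v $ 2 = - v $ 1" "area_op v $ 3 = v $ 2"
  by (simp_all add: area_op_def)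

text \<open>This says that the area form is parallel, because its components in the coordinate frame
  are constant.\<close>

lemma area_Gam:
  assumes "smooth_on UNIV f"
  shows "area (Gam (metric_M f) p u v) w + area v (Gam (metric_M f) p u w) = 0"
  by (simp add: Gam_metric_M[OF assms] area_def)

lemma area_op_Gam:
  assumes "smooth_on UNIV f"
  shows "area_op (Gam (metric_M f) p u v) = Gam (metric_M f) p u (area_op v)"
  by (simp add: Gam_metric_M[OF assms] vec_eq_iff forall_3)

text \<open>The terms quadratic in the connection are symmetric in \<open>u\<close> and \<open>v\<close> and cancel, so only the
  derivative of the Christoffel symbols, which involves \<open>f''\<close>, is left.\<close>

lemma curv_operator_metric_M:
  assumes "smooth_on UNIV f"
  shows "curv_operator (metric_M f) (\<lambda>_. u) (\<lambda>_. v) (\<lambda>_. w) p =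
    ((deriv ^^ 2) f (p $ 2) * area u v) *\<^sub>R area_op w"
proof -
  let ?g = "metric_M f"
  define K :: "real^3 \<Rightarrow> real^3 \<Rightarrow> real^3"
    where "K u v = vector [0, u $ 1 * v $ 1, - (u $ 1 * v $ 2 + u $ 2 * v $ 1)]" for u v
  have G: "Gam ?g q a b = deriv f (q $ 2) *\<^sub>R K a b" for q a b
    unfolding K_def by (rule Gam_metric_M[OF assms])
  have n: "nabla ?g (\<lambda>_. a) (\<lambda>_. b) = (\<lambda>q. deriv f (q $ 2) *\<^sub>R K a b)" for a b
    by (simp add: fun_eq_iff nabla_const G)
  have d: "((\<lambda>q. deriv f (q $ 2) *\<^sub>R K a b) has_derivative
      (\<lambda>u. ((deriv ^^ 2) f (p $ 2) * u $ 2) *\<^sub>R K a b)) (at p)" for a b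
    by (intro has_derivative_scaleR_left has_derivative_profile deriv_1_smooth assms)
  have fd: "frechet_derivative (\<lambda>q. deriv f (q $ 2) *\<^sub>R K a b) (at p) =
      (\<lambda>u. ((deriv ^^ 2) f (p $ 2) * u $ 2) *\<^sub>R K a b)" for a b
    by (rule frechet_derivative_at[OF d, symmetric])
  have "lie_bracket (\<lambda>_. u) (\<lambda>_. v) = (\<lambda>_. 0)"
    by (simp add: lie_bracket_def)
  then have "nabla ?g (lie_bracket (\<lambda>_. u) (\<lambda>_. v)) (\<lambda>_. w) p = 0"
    by (simp only: nabla_const Gam_zero_left[OF assms])
  moreover have "nabla ?g (\<lambda>_. a) (nabla ?g (\<lambda>_. b) (\<lambda>_. w)) p =
      ((deriv ^^ 2) f (p $ 2) * a $ 2) *\<^sub>R K b w + deriv f (p $ 2) *\<^sub>R K a (deriv f (p $ 2) *\<^sub>R K b w)" for a b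
    unfolding n unfolding nabla_def fd G ..
  ultimately have "curv_operator ?g (\<lambda>_. u) (\<lambda>_. v) (\<lambda>_. w) p =
      (((deriv ^^ 2) f (p $ 2) * u $ 2) *\<^sub>R K v w + deriv f (p $ 2) *\<^sub>R K u (deriv f (p $ 2) *\<^sub>R K v w)) -
      (((deriv ^^ 2) f (p $ 2) * v $ 2) *\<^sub>R K u w + deriv f (p $ 2) *\<^sub>R K v (deriv f (p $ 2) *\<^sub>R K u w))"
    by (simp only: curv_operator_def diff_zero)
  then show ?thesis
    by (simp add: K_def vec_eq_iff forall_3 area_def algebra_simps)
qed

lemma curv_op_tensor_metric_M:
  assumes "smooth_on UNIV f"
  shows "curv_op_tensor (metric_M f) p vs =
    ((deriv ^^ 2) f (p $ 2) * area (vs ! 0) (vs ! 1)) *\<^sub>R area_op (vs ! 2)"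
  by (simp only: curv_op_tensor_def curv_operator_metric_M[OF assms])

lemma curv_tensor_metric_M:
  assumes "smooth_on UNIV f"
  shows "curv_tensor (metric_M f) p vs =
    - (area (vs ! 0) (vs ! 1) * area (vs ! 2) (vs ! 3) * (deriv ^^ 2) f (p $ 2))"
  by (simp add: curv_tensor_def curv_operator_metric_M[OF assms] ip_metric_M area_def algebra_simps)

section \<open>Covariant derivatives of the curvature\<close>

text \<open>All coefficients that occur in covariant derivatives of the curvature are differential
  polynomials in \<open>f\<close>. Working in the ring that they form gives differentiability to every order
  from the single rule that the ring is closed under differentiation.\<close>

inductive_set diff_ring :: "(real \<Rightarrow> real) \<Rightarrow> (real \<Rightarrow> real) set" for f where
  gen: "(deriv ^^ n) f \<in> diff_ring f"
| const: "(\<lambda>_. c) \<in> diff_ring f"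
| add: "\<lbrakk>g \<in> diff_ring f; h \<in> diff_ring f\<rbrakk> \<Longrightarrow> (\<lambda>y. g y + h y) \<in> diff_ring f"
| mult: "\<lbrakk>g \<in> diff_ring f; h \<in> diff_ring f\<rbrakk> \<Longrightarrow> (\<lambda>y. g y * h y) \<in> diff_ring f"

lemma diff_ring_deriv:
  assumes "smooth_on UNIV f" and "h \<in> diff_ring f"
  shows "\<exists>h'\<in>diff_ring f. \<forall>y. (h has_real_derivative h' y) (at y)"
  using assms(2)
proof induction
  case (gen n)
  show ?case
    using diff_ring.gen[of "Suc n" f] deriv_funpow[OF assms(1), of n] by blast
next
  case (const c)
  show ?case
    by (intro bexI[of _ "\<lambda>_. 0"]) (auto intro: diff_ring.const)
next
  case (add g h)
  then obtain g' h' where "g' \<in> diff_ring f" "h' \<in> diff_ring f"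
    "\<And>y. (g has_real_derivative g' y) (at y)" "\<And>y. (h has_real_derivative h' y) (at y)"
    by blast
  then show ?case
    by (intro bexI[of _ "\<lambda>y. g' y + h' y"]) (auto intro: diff_ring.add DERIV_add)
next
  case (mult g h)
  then obtain g' h' where "g' \<in> diff_ring f" "h' \<in> diff_ring f"
    "\<And>y. (g has_real_derivative g' y) (at y)" "\<And>y. (h has_real_derivative h' y) (at y)"
    by blast
  with mult show ?case
    by (intro bexI[of _ "\<lambda>y. g' y * h y + h' y * g y"])
      (auto intro: diff_ring.add diff_ring.mult DERIV_mult)
qed

lemma diff_ring_sum:
  assumes "finite A" and "\<And>i. i \<in> A \<Longrightarrow> h i \<in> diff_ring f"
  shows "(\<lambda>y. \<Sum>i\<in>A. h i y) \<in> diff_ring f"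
  using assms by (induction rule: finite_induct) (auto intro: diff_ring.const diff_ring.add)

text \<open>Tensors whose coefficients depend on \<open>y\<close> alone and which the null direction \<open>e3\<close>
  annihilates. Since \<open>e3\<close> is parallel, covariant differentiation preserves this class; the class
  makes the covariant derivative computable, because the connection can then be taken modulo
  \<open>e3\<close>.\<close>

definition profile_tensor :: "(real \<Rightarrow> real) \<Rightarrow> nat \<Rightarrow> 3 tensor \<Rightarrow> bool" where
  "profile_tensor f r T \<longleftrightarrow>
     (\<forall>vs. length vs = r \<longrightarrow> (\<exists>h\<in>diff_ring f. \<forall>p. T p vs = h (p $ 2))) \<and>
     (\<forall>p vs i. length vs = r \<longrightarrow> i < r \<longrightarrow>
        linear (\<lambda>x. T p (vs[i := x])) \<and> T p (vs[i := e3]) = 0)"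

lemma profile_tensor_coeff:
  assumes "smooth_on UNIV f" "profile_tensor f r T" "length vs = r"
  shows "\<exists>h\<in>diff_ring f. \<exists>h'\<in>diff_ring f. (\<forall>p. T p vs = h (p $ 2)) \<and>
    (\<forall>y. (h has_real_derivative h' y) (at y))"
  using assms diff_ring_deriv[OF assms(1)] unfolding profile_tensor_def by blast

text \<open>The function \<open>\<lambda>y. T (y *\<^sub>R e2) vs\<close> is the coefficient of \<open>T\<close> as a function of the
  coordinate \<open>y\<close>.\<close>

lemma profile_tensor_frechet:
  assumes "smooth_on UNIV f" "profile_tensor f r T" "length vs = r"
  shows "((\<lambda>q. T q vs) has_derivative (\<lambda>u. deriv (\<lambda>y. T (y *\<^sub>R e2) vs) (p $ 2) * u $ 2)) (at p)"
    and "((\<lambda>y. T (y *\<^sub>R e2) vs) has_real_derivative deriv (\<lambda>y. T (y *\<^sub>R e2) vs) y) (at y)"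
    and "T p vs = T ((p $ 2) *\<^sub>R e2) vs"
proof -
  from profile_tensor_coeff[OF assms] obtain h h' where T: "\<And>p. T p vs = h (p $ 2)"
    and d: "\<And>y. (h has_real_derivative h' y) (at y)"
    by blast
  have h: "(\<lambda>y. T (y *\<^sub>R e2) vs) = h"
    by (simp add: T)
  have "deriv h = h'"
    using DERIV_imp_deriv[OF d] by blast
  then show "((\<lambda>q. T q vs) has_derivative (\<lambda>u. deriv (\<lambda>y. T (y *\<^sub>R e2) vs) (p $ 2) * u $ 2)) (at p)"
    and "((\<lambda>y. T (y *\<^sub>R e2) vs) has_real_derivative deriv (\<lambda>y. T (y *\<^sub>R e2) vs) y) (at y)"
    using d has_derivative_profile[OF d] unfolding h by (simp_all add: T)
  show "T p vs = T ((p $ 2) *\<^sub>R e2) vs"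
    by (simp add: T)
qed

lemma cov_deriv_snoc:
  "cov_deriv g T p (ws @ [u]) = frechet_derivative (\<lambda>q. T q ws) (at p) u
     - (\<Sum>i<length ws. T p (ws[i := Gam g p u (ws ! i)]))"
  by (simp add: cov_deriv_def nabla_const)

text \<open>Modulo \<open>e3\<close>, the covariant derivative \<open>\<nabla>\<^sub>u w\<close> of a constant field is \<open>f' u\<^sub>1 w\<^sub>1 e2\<close>.\<close>

lemma cov_deriv_profile:
  assumes f: "smooth_on UNIV f" and T: "profile_tensor f r T" and r: "length ws = r"
  shows "cov_deriv (metric_M f) T p (ws @ [u]) =
    u $ 2 * deriv (\<lambda>y. T (y *\<^sub>R e2) ws) (p $ 2)
      - (\<Sum>i<r. deriv f (p $ 2) * u $ 1 * (ws ! i $ 1 * T p (ws[i := e2])))"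
proof -
  have "T p (ws[i := Gam (metric_M f) p u (ws ! i)]) =
      deriv f (p $ 2) * u $ 1 * (ws ! i $ 1 * T p (ws[i := e2]))" if "i < r" for i
  proof -
    let ?w = "ws ! i"
    have G: "Gam (metric_M f) p u ?w = (deriv f (p $ 2) * u $ 1 * ?w $ 1) *\<^sub>R e2
        + (- deriv f (p $ 2) * (u $ 1 * ?w $ 2 + u $ 2 * ?w $ 1)) *\<^sub>R e3"
      by (simp add: Gam_metric_M[OF f] vec_eq_iff forall_3 algebra_simps)
    have l: "linear (\<lambda>x. T p (ws[i := x]))" and z: "T p (ws[i := e3]) = 0"
      using T r that unfolding profile_tensor_def by blast+
    show ?thesis
      unfolding G by (simp add: linear_add[OF l] linear_scale[OF l] linear_diff[OF l] z)
  qed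
  then show ?thesis
    unfolding cov_deriv_snoc
    using r by (simp flip: frechet_derivative_at[OF profile_tensor_frechet(1)[OF f T r]])
qed

lemma profile_tensor_cov_deriv:
  assumes f: "smooth_on UNIV f" and T: "profile_tensor f r T"
  shows "profile_tensor f (Suc r) (cov_deriv (metric_M f) T)"
  unfolding profile_tensor_def
proof (intro conjI allI impI)
  fix vs :: "(real^3) list"
  assume "length vs = Suc r"
  then obtain ws u where vs: "vs = ws @ [u]" and r: "length ws = r"
    by (metis length_Suc_conv_rev)
  obtain h h' where h: "\<And>p. T p ws = h (p $ 2)" and h': "h' \<in> diff_ring f"
    "\<And>y. (h has_real_derivative h' y) (at y)"
    using profile_tensor_coeff[OF f T r] by blast
  have "\<exists>k\<in>diff_ring f. \<forall>p. T p (ws[i := e2]) = k (p $ 2)" for i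
    using T r unfolding profile_tensor_def by simp
  then obtain k where k: "\<And>i. k i \<in> diff_ring f" "\<And>i p. T p (ws[i := e2]) = k i (p $ 2)"
    by metis
  have h'd: "deriv h = h'"
    using DERIV_imp_deriv[OF h'(2)] by blast
  have "(\<lambda>y. u $ 2 * h' y + (\<Sum>i<r. (- u $ 1 * ws ! i $ 1) * (deriv f y * k i y))) \<in> diff_ring f"
    using diff_ring.gen[of 1 f]
    by (intro diff_ring.add diff_ring_sum diff_ring.mult diff_ring.const h'(1) k(1)) auto
  then show "\<exists>h\<in>diff_ring f. \<forall>p. cov_deriv (metric_M f) T p vs = h (p $ 2)"
    by (rule bexI[rotated]) (simp add: vs cov_deriv_profile[OF f T r] h k(2) h'd sum_negf mult_ac)
next
  fix p :: "real^3" and vs :: "(real^3) list" and i :: nat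
  assume "length vs = Suc r" and i: "i < Suc r"
  then obtain ws u where vs: "vs = ws @ [u]" and r: "length ws = r"
    by (metis length_Suc_conv_rev)
  note C = cov_deriv_profile[OF f T]
  have "linear (\<lambda>x. cov_deriv (metric_M f) T p (vs[i := x])) \<and>
    cov_deriv (metric_M f) T p (vs[i := e3]) = 0"
  proof (cases "i = r")
    case True
    then have "vs[i := x] = ws @ [x]" for x
      using r by (auto simp: vs)
    then show ?thesis
      by (auto intro!: linearI simp: C[OF r] algebra_simps sum.distrib sum_distrib_left)
  next
    case False
    with i have i: "i < r" by simp
    have vsi: "vs[i := x] = ws[i := x] @ [u]" for x
      using i r by (simp add: vs list_update_append)
    define D where "D x = deriv (\<lambda>y. T (y *\<^sub>R e2) (ws[i := x])) (p $ 2)" for x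
    have lT: "linear (\<lambda>x. T q (ws'[j := x]))" and zT: "T q (ws'[j := e3]) = 0"
      if "length ws' = r" "j < r" for q j ws'
      using T that unfolding profile_tensor_def by blast+
    have dT: "((\<lambda>y. T (y *\<^sub>R e2) (ws[i := x])) has_real_derivative D x) (at (p $ 2))" for x
      unfolding D_def by (rule profile_tensor_frechet(2)[OF f T]) (simp add: r)
    have D_add: "D (x + x') = D x + D x'" for x x'
      using DERIV_imp_deriv[OF DERIV_add[OF dT[of x] dT[of x']]]
      by (simp add: D_def[of "x + x'"] linear_add[OF lT[OF r i]])
    have D_scale: "D (a *\<^sub>R x) = a * D x" for a x
      using DERIV_imp_deriv[OF DERIV_cmult[OF dT[of x], of a]]
      by (simp add: D_def[of "a *\<^sub>R x"] linear_scale[OF lT[OF r i]])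
    have D_e3: "D e3 = 0"
      by (simp add: D_def zT[OF r i])
    have S: "linear (\<lambda>x. ws[i := x] ! j $ 1 * T p (ws[i := x, j := e2]))"
      "ws[i := e3] ! j $ 1 * T p (ws[i := e3, j := e2]) = 0" if j: "j < r" for j
    proof -
      show "linear (\<lambda>x. ws[i := x] ! j $ 1 * T p (ws[i := x, j := e2]))"
      proof (cases "j = i")
        case True
        then show ?thesis
          using i r by (auto intro!: linearI simp: algebra_simps)
      next
        case False
        have l: "linear (\<lambda>x. T p (ws[j := e2, i := x]))"
          by (rule lT) (simp_all add: r i)
        show ?thesis
          using False by (auto intro!: linearI
              simp: list_update_swap[of i j] linear_add[OF l] linear_scale[OF l] algebra_simps)
      qed
      show "ws[i := e3] ! j $ 1 * T p (ws[i := e3, j := e2]) = 0"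
        using zT[of "ws[j := e2]" i p] i r by (cases "j = i") (auto simp: list_update_swap[of i j])
    qed
    define E where "E x = (\<Sum>j<r. deriv f (p $ 2) * u $ 1 * (ws[i := x] ! j $ 1 * T p (ws[i := x, j := e2])))" for x
    have E: "linear E" "E e3 = 0"
      unfolding E_def using S
      by (auto intro!: linear_compose_sum linear_compose_scale_right[where 'b = real, simplified] sum.neutral)
    have eq: "cov_deriv (metric_M f) T p (vs[i := x]) = u $ 2 * D x - E x" for x
      unfolding vsi using C[of "ws[i := x]" p u] r by (simp add: D_def E_def)
    show ?thesis
      unfolding eq by (auto intro!: linearI
          simp: D_add D_scale D_e3 E(2) linear_add[OF E(1)] linear_scale[OF E(1)] algebra_simps)
  qed
  then show "linear (\<lambda>x. cov_deriv (metric_M f) T p (vs[i := x]))"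
    and "cov_deriv (metric_M f) T p (vs[i := e3]) = 0"
    by blast+
qed

text \<open>The covariant derivatives of the function \<open>F = f''\<close> on the manifold. By the next results
  they carry all information in the covariant derivatives of the curvature.\<close>

definition nabla_F :: "(real \<Rightarrow> real) \<Rightarrow> nat \<Rightarrow> 3 tensor" where
  "nabla_F f k = (cov_deriv (metric_M f) ^^ k) (\<lambda>p vs. (deriv ^^ 2) f (p $ 2))"

lemma profile_tensor_nabla_F:
  assumes "smooth_on UNIV f"
  shows "profile_tensor f k (nabla_F f k)"
proof (induction k)
  case 0
  show ?case
    using diff_ring.gen[of 2 f] unfolding profile_tensor_def nabla_F_def by auto
next
  case (Suc k)
  then show ?case
    using profile_tensor_cov_deriv[OF assms] by (simp add: nabla_F_def)
qed

lemma nabla_F_Suc: "nabla_F f (Suc k) = cov_deriv (metric_M f) (nabla_F f k)"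
  by (simp add: nabla_F_def)

lemma nabla_F_0: "nabla_F f 0 p vs = (deriv ^^ 2) f (p $ 2)"
  by (simp add: nabla_F_def)

lemma nabla_F_1:
  assumes "smooth_on UNIV f"
  shows "nabla_F f 1 p [u] = (deriv ^^ 3) f (p $ 2) * u $ 2"
  using cov_deriv_profile[OF assms profile_tensor_nabla_F[OF assms, of 0], of "[]" p u]
  by (simp add: nabla_F_Suc nabla_F_0[abs_def] numeral_3_eq_3 numeral_2_eq_2)

text \<open>The term in \<open>dx\<^sup>2\<close> is the reason why second derivatives of the curvature see \<open>f'\<close>: it
  comes from \<open>\<nabla>\<^sub>x \<partial>\<^sub>x = f' \<partial>\<^sub>y\<close>.\<close>

lemma nabla_F_2:
  assumes "smooth_on UNIV f"
  shows "nabla_F f 2 p [u, w] = (deriv ^^ 4) f (p $ 2) * u $ 2 * w $ 2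
    - deriv f (p $ 2) * (deriv ^^ 3) f (p $ 2) * u $ 1 * w $ 1"
proof -
  have d: "deriv (\<lambda>y. (deriv ^^ 3) f y * c) y = (deriv ^^ 4) f y * c" for c y
    using DERIV_imp_deriv[OF DERIV_cmult_right[OF deriv_funpow[OF assms, of 3]]]
    by (simp add: numeral_eq_Suc)
  show ?thesis
    using cov_deriv_profile[OF assms profile_tensor_nabla_F[OF assms, of 1], of "[u]" p w]
    by (simp add: nabla_F_Suc[of f 1, simplified, folded numeral_2_eq_2] nabla_F_1[OF assms, simplified] d)
qed

lemma nabla_F_depends_on_y:
  assumes "smooth_on UNIV f" "length vs = k"
  shows "nabla_F f k p vs = nabla_F f k ((p $ 2) *\<^sub>R e2) vs"
  by (rule profile_tensor_frechet(3)[OF assms(1) profile_tensor_nabla_F[OF assms(1)] assms(2)])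

lemma sum_lessThan_split:
  fixes F :: "nat \<Rightarrow> 'a::comm_monoid_add"
  shows "(\<Sum>i<m + k. F i) = (\<Sum>i<m. F i) + (\<Sum>i<k. F (m + i))"
  by (induction k) (simp_all add: add.assoc)

lemma sum_lessThan_3_4:
  fixes F :: "nat \<Rightarrow> 'a::comm_monoid_add"
  shows "(\<Sum>i<3. F i) = F 0 + F 1 + F 2" "(\<Sum>i<4. F i) = F 0 + F 1 + F 2 + F 3"
  by (simp_all add: numeral_eq_Suc)

text \<open>The product rule, with the area form parallel: the terms in which the connection acts on
  one of the first four arguments cancel in pairs.\<close>

lemma nabla_R_metric_M:
  assumes f: "smooth_on UNIV f" and "length vs = 4 + k"
  shows "nabla_R (metric_M f) k p vs =
    - (area (vs ! 0) (vs ! 1) * area (vs ! 2) (vs ! 3) * nabla_F f k p (drop 4 vs))"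
  using assms(2)
proof (induction k arbitrary: p vs)
  case 0
  then show ?case
    by (simp add: nabla_R_def curv_tensor_metric_M[OF f] nabla_F_0)
next
  case (Suc k)
  then obtain ws u where vs: "vs = ws @ [u]" and r: "length ws = 4 + k"
    by (metis add_Suc_right length_Suc_conv_rev)
  let ?g = "metric_M f"
  define A where "A = area (ws ! 0) (ws ! 1) * area (ws ! 2) (ws ! 3)"
  define us where "us = drop 4 ws"
  have us: "length us = k"
    by (simp add: us_def r)
  define X where "X i = ws[i := Gam ?g p u (ws ! i)]" for i
  have F: "nabla_R ?g k q ws = - A * nabla_F f k q us" for q
    using Suc.IH[OF r] by (simp add: A_def us_def)
  have "((\<lambda>q. nabla_R ?g k q ws) has_derivative
      (\<lambda>u. - A * (deriv (\<lambda>y. nabla_F f k (y *\<^sub>R e2) us) (p $ 2) * u $ 2))) (at p)"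
    unfolding F
    by (intro has_derivative_mult_right profile_tensor_frechet(1)[OF f profile_tensor_nabla_F[OF f] us])
  then have d: "frechet_derivative (\<lambda>q. nabla_R ?g k q ws) (at p) u =
      - A * frechet_derivative (\<lambda>q. nabla_F f k q us) (at p) u"
    by (simp flip: frechet_derivative_at
          frechet_derivative_at[OF profile_tensor_frechet(1)[OF f profile_tensor_nabla_F[OF f] us]])
  have "(\<Sum>i<4. nabla_R ?g k p (X i)) =
     - ((area (Gam ?g p u (ws ! 0)) (ws ! 1) + area (ws ! 0) (Gam ?g p u (ws ! 1))) * area (ws ! 2) (ws ! 3)
       + area (ws ! 0) (ws ! 1) * (area (Gam ?g p u (ws ! 2)) (ws ! 3) + area (ws ! 2) (Gam ?g p u (ws ! 3))))
       * nabla_F f k p us"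
    using r by (simp add: sum_lessThan_3_4 Suc.IH X_def us_def drop_update_cancel algebra_simps)
  then have S4: "(\<Sum>i<4. nabla_R ?g k p (X i)) = 0"
    by (simp add: area_Gam[OF f])
  have "nabla_R ?g k p (X (4 + i)) = - A * nabla_F f k p (us[i := Gam ?g p u (us ! i)])" if "i < k" for i
    using r that by (simp add: Suc.IH X_def us_def drop_update_swap A_def)
  then have Sk: "(\<Sum>i<k. nabla_R ?g k p (X (4 + i))) =
      - A * (\<Sum>i<k. nabla_F f k p (us[i := Gam ?g p u (us ! i)]))"
    by (simp only: sum_distrib_left) simp
  have "nabla_R ?g (Suc k) p vs = - A * frechet_derivative (\<lambda>q. nabla_F f k q us) (at p) u
      - (\<Sum>i<4 + k. nabla_R ?g k p (X i))"
    using d r by (simp add: nabla_R_def vs cov_deriv_snoc X_def)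
  also have "\<dots> = - A * cov_deriv ?g (nabla_F f k) p (us @ [u])"
    unfolding sum_lessThan_split[of _ 4 k] S4 Sk
    by (simp add: us cov_deriv_snoc algebra_simps)
  finally show ?case
    using r by (simp add: nabla_F_Suc A_def us_def vs nth_append)
qed

text \<open>The same argument for the curvature operator; here the term in which the connection acts
  on the third argument cancels against its action on the value, because \<open>area_op\<close> is parallel
  too.\<close>

lemma nabla_R_op_metric_M:
  assumes f: "smooth_on UNIV f" and "length vs = 3 + k"
  shows "nabla_R_op (metric_M f) k p vs =
    (area (vs ! 0) (vs ! 1) * nabla_F f k p (drop 3 vs)) *\<^sub>R area_op (vs ! 2)"
  using assms(2)
proof (induction k arbitrary: p vs)
  case 0
  then show ?case
    by (simp add: nabla_R_op_def curv_op_tensor_metric_M[OF f] nabla_F_0 mult.commute)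
next
  case (Suc k)
  then obtain ws u where vs: "vs = ws @ [u]" and r: "length ws = 3 + k"
    by (metis add_Suc_right length_Suc_conv_rev)
  let ?g = "metric_M f"
  define a where "a = area (ws ! 0) (ws ! 1)"
  define us where "us = drop 3 ws"
  have us: "length us = k"
    by (simp add: us_def r)
  define X where "X i = ws[i := Gam ?g p u (ws ! i)]" for i
  have F: "nabla_R_op ?g k q ws = nabla_F f k q us *\<^sub>R (a *\<^sub>R area_op (ws ! 2))" for q
    using Suc.IH[OF r] by (simp add: a_def us_def mult.commute)
  have "((\<lambda>q. nabla_R_op ?g k q ws) has_derivative
      (\<lambda>u. (deriv (\<lambda>y. nabla_F f k (y *\<^sub>R e2) us) (p $ 2) * u $ 2) *\<^sub>R (a *\<^sub>R area_op (ws ! 2)))) (at p)"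
    unfolding F
    by (intro has_derivative_scaleR_left profile_tensor_frechet(1)[OF f profile_tensor_nabla_F[OF f] us])
  then have d: "frechet_derivative (\<lambda>q. nabla_R_op ?g k q ws) (at p) u =
      frechet_derivative (\<lambda>q. nabla_F f k q us) (at p) u *\<^sub>R (a *\<^sub>R area_op (ws ! 2))"
    by (simp flip: frechet_derivative_at
          frechet_derivative_at[OF profile_tensor_frechet(1)[OF f profile_tensor_nabla_F[OF f] us]])
  have "(\<Sum>i<3. nabla_R_op ?g k p (X i)) =
     ((area (Gam ?g p u (ws ! 0)) (ws ! 1) + area (ws ! 0) (Gam ?g p u (ws ! 1))) * nabla_F f k p us) *\<^sub>R area_op (ws ! 2)
       + (a * nabla_F f k p us) *\<^sub>R area_op (Gam ?g p u (ws ! 2))"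
    using r by (simp add: sum_lessThan_3_4 Suc.IH X_def us_def a_def drop_update_cancel algebra_simps)
  then have S3: "(\<Sum>i<3. nabla_R_op ?g k p (X i)) = (a * nabla_F f k p us) *\<^sub>R Gam ?g p u (area_op (ws ! 2))"
    by (simp add: area_Gam[OF f] area_op_Gam[OF f])
  have "nabla_R_op ?g k p (X (3 + i)) =
      nabla_F f k p (us[i := Gam ?g p u (us ! i)]) *\<^sub>R (a *\<^sub>R area_op (ws ! 2))" if "i < k" for i
    using r that by (simp add: Suc.IH X_def us_def drop_update_swap a_def mult.commute)
  then have Sk: "(\<Sum>i<k. nabla_R_op ?g k p (X (3 + i))) =
      (\<Sum>i<k. nabla_F f k p (us[i := Gam ?g p u (us ! i)])) *\<^sub>R (a *\<^sub>R area_op (ws ! 2))"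
    by (simp only: scaleR_sum_left) simp
  have G: "Gam ?g p u (c *\<^sub>R v) = c *\<^sub>R Gam ?g p u v" for c v
    by (simp add: Gam_metric_M[OF f] vec_eq_iff forall_3 algebra_simps)
  have "nabla_R_op ?g (Suc k) p vs = frechet_derivative (\<lambda>q. nabla_F f k q us) (at p) u *\<^sub>R (a *\<^sub>R area_op (ws ! 2))
      + (a * nabla_F f k p us) *\<^sub>R Gam ?g p u (area_op (ws ! 2)) - (\<Sum>i<3 + k. nabla_R_op ?g k p (X i))"
    using d r F[of p] by (simp add: nabla_R_op_def vs cov_deriv_vec_def nabla_def X_def G mult.commute)
  also have "\<dots> = cov_deriv ?g (nabla_F f k) p (us @ [u]) *\<^sub>R (a *\<^sub>R area_op (ws ! 2))"
    unfolding sum_lessThan_split[of _ 3 k] S3 Sk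
    by (simp add: us cov_deriv_snoc algebra_simps)
  finally show ?case
    using r by (simp add: nabla_F_Suc a_def us_def vs nth_append mult.commute)
qed

section \<open>Scalar Weyl invariants\<close>

lemma nabla_F_e3:
  assumes "smooth_on UNIV f" "length vs = k" "e3 \<in> set vs"
  shows "nabla_F f k p vs = 0"
proof -
  obtain i where i: "i < k" "vs ! i = e3"
    using assms by (metis in_set_conv_nth)
  then have "nabla_F f k p (vs[i := e3]) = 0"
    using profile_tensor_nabla_F[OF assms(1), of k] assms(2) unfolding profile_tensor_def by blast
  then show ?thesis
    using i by (metis list_update_id)
qed

lemma nabla_R_e3:
  assumes "smooth_on UNIV f" "length vs = 4 + k" "e3 \<in> set vs"
  shows "nabla_R (metric_M f) k p vs = 0"
proof -
  obtain i where i: "i < 4 + k" "vs ! i = e3"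
    using assms by (metis in_set_conv_nth)
  have "i = 0 \<or> i = 1 \<or> i = 2 \<or> i = 3 \<or> e3 \<in> set (drop 4 vs)"
  proof (cases "i < 4")
    case False
    then have "drop 4 vs ! (i - 4) = e3" "i - 4 < length (drop 4 vs)"
      using i assms(2) by auto
    then show ?thesis
      by (metis nth_mem)
  qed auto
  then show ?thesis
    using i(2) nabla_F_e3[OF assms(1), of "drop 4 vs" k p] assms(2)
    by (auto simp: nabla_R_metric_M[OF assms(1,2)] area_def)
qed

lemma nabla_R_prod_e3:
  assumes "smooth_on UNIV f" "length vs = (\<Sum>k\<leftarrow>ks. 4 + k)" "e3 \<in> set vs"
  shows "nabla_R_prod (metric_M f) ks p vs = 0"
  using assms(2,3)
proof (induction ks arbitrary: vs)
  case (Cons k ks)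
  have "e3 \<in> set (take (4 + k) vs) \<or> e3 \<in> set (drop (4 + k) vs)"
    using Cons.prems(2) by (metis Un_iff append_take_drop_id set_append)
  then show ?case
    using Cons nabla_R_e3[OF assms(1), of "take (4 + k) vs" k p] by auto
qed simp

lemma nabla_R_prod_e2:
  assumes "smooth_on UNIV f" "length vs = (\<Sum>k\<leftarrow>ks. 4 + k)" "set vs \<subseteq> {e2}" "ks \<noteq> []"
  shows "nabla_R_prod (metric_M f) ks p vs = 0"
proof -
  obtain k ks' where ks: "ks = k # ks'"
    using assms(4) by (cases ks) auto
  have "i < length vs \<Longrightarrow> vs ! i = e2" for i
    using assms(3) nth_mem by blast
  then have "vs ! 0 = e2" "vs ! 1 = e2"
    using assms(2) by (simp_all add: ks)
  then show ?thesis
    using assms(2) nabla_R_metric_M[OF assms(1), of "take (4 + k) vs" k p]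
    by (simp add: ks area_def)
qed

text \<open>The inverse metric pairs the index 1 with the index 3 only, and an index 3 is annihilated
  by the curvature factors. So in a nonzero term of the contraction all indices would be 2; but
  then the area form vanishes.\<close>

lemma full_contraction_metric_M:
  assumes f: "smooth_on UNIV f" and ks: "ks \<noteq> []" and r: "r = (\<Sum>k\<leftarrow>ks. 4 + k)"
    and \<sigma>: "pairing r \<sigma>"
  shows "full_contraction (metric_M f) r \<sigma> (nabla_R_prod (metric_M f) ks) p = 0"
  unfolding full_contraction_def
proof (intro sum.neutral ballI)
  fix a :: "3 list"
  assume "a \<in> {a. length a = r}"
  then have a: "length a = r" by simp
  let ?g = "matrix_inv (metric_M f p)" and ?vs = "map (\<lambda>i. axis i 1) a :: (real^3) list"
  let ?G = "\<Prod>i\<in>{i. i < r \<and> i < \<sigma> i}. ?g $ (a ! i) $ (a ! \<sigma> i)"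
  have "x = 2" if "3 \<notin> set a" "1 \<notin> set a" "x \<in> set a" for x
    using exhaust_3[of x] that by auto
  then consider "3 \<in> set a" | "set a \<subseteq> {2}" | "3 \<notin> set a" "1 \<in> set a"
    by blast
  then have "?G = 0 \<or> nabla_R_prod (metric_M f) ks p ?vs = 0"
  proof cases
    case 1
    then show ?thesis
      using a r by (intro disjI2 nabla_R_prod_e3[OF f]) auto
  next
    case 2
    then show ?thesis
      using a r by (intro disjI2 nabla_R_prod_e2[OF f _ _ ks]) auto
  next
    case 3
    then obtain i where i: "i < r" "a ! i = 1"
      using a by (metis in_set_conv_nth)
    have si: "\<sigma> i < r" "\<sigma> i \<noteq> i" "\<sigma> (\<sigma> i) = i"
      using \<sigma> i(1) unfolding pairing_def by auto
    have "a ! \<sigma> i = 1 \<or> a ! \<sigma> i = 2"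
      using 3(1) si(1) a exhaust_3[of "a ! \<sigma> i"] by (metis nth_mem)
    then have 0: "?g $ (a ! i) $ (a ! \<sigma> i) = 0" "?g $ (a ! \<sigma> i) $ (a ! i) = 0"
      by (auto simp: i(2) matrix_inv_metric_M)
    have "\<exists>j\<in>{i. i < r \<and> i < \<sigma> i}. ?g $ (a ! j) $ (a ! \<sigma> j) = 0"
    proof (cases "i < \<sigma> i")
      case True
      then show ?thesis using i(1) 0(1) by blast
    next
      case False
      then show ?thesis using si 0(2) by (intro bexI[of _ "\<sigma> i"]) auto
    qed
    then have "?G = 0"
      by (intro prod_zero) auto
    then show ?thesis ..
  qed
  then show "?G * nabla_R_prod (metric_M f) ks p ?vs = 0"
    by auto
qed

lemma scalar_weyl_invariant_metric_M:
  assumes f: "smooth_on UNIV f" and "scalar_weyl_invariant (metric_M f) I"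
  shows "I p = 0"
  using assms(2) by induction (auto simp: full_contraction_metric_M[OF f])

section \<open>The symmetric spaces\<close>

lemma smooth_quadratic: "smooth_on UNIV (\<lambda>y::real. a * y\<^sup>2 + b * y + c)"
proof -
  have "Ck_on k UNIV (\<lambda>y::real. a * y\<^sup>2 + b * y + c)" for k
  proof (induction k arbitrary: a b c)
    case 0
    show ?case
      by (auto intro!: continuous_intros)
  next
    case (Suc k)
    have d: "((\<lambda>y::real. a * y\<^sup>2 + b * y + c) has_derivative (\<lambda>v. (2 * a * y + b) * v)) (at y)" for y
      by (auto intro!: derivative_eq_intros simp: algebra_simps)
    have "frechet_derivative (\<lambda>y::real. a * y\<^sup>2 + b * y + c) (at p) v = 0 * p\<^sup>2 + (2 * a * v) * p + b * v"
      for p v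
      unfolding frechet_derivative_at[OF d, symmetric] by (simp add: algebra_simps)
    then have "Ck_on k UNIV (\<lambda>p. frechet_derivative (\<lambda>y::real. a * y\<^sup>2 + b * y + c) (at p) v)" for v
      by (simp only: Suc)
    then show ?case
      using d by (auto simp: differentiable_def)
  qed
  then show ?thesis
    by (simp add: smooth_on_def)
qed

lemma profile_S:
  fixes \<epsilon> :: real
  defines "f \<equiv> \<lambda>y. \<epsilon> * y\<^sup>2 / 2"
  shows "smooth_on UNIV f" "(deriv ^^ 2) f y = \<epsilon>" "(deriv ^^ 3) f y = 0"
proof -
  show "smooth_on UNIV f"
    using smooth_quadratic[of "\<epsilon> / 2" 0 0] by (simp add: f_def)
  have 1: "deriv f = (\<lambda>y. \<epsilon> * y)"
    by (intro ext DERIV_imp_deriv) (auto simp: f_def intro!: derivative_eq_intros)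
  have 2: "deriv (\<lambda>y. \<epsilon> * y) = (\<lambda>_. \<epsilon>)"
    by (intro ext DERIV_imp_deriv) (auto intro!: derivative_eq_intros)
  show "(deriv ^^ 2) f y = \<epsilon>" "(deriv ^^ 3) f y = 0"
    by (simp_all add: numeral_eq_Suc 1 2)
qed

lemma local_symmetric_S: "local_symmetric (metric_S \<epsilon>)"
  unfolding local_symmetric_def
proof (intro allI impI)
  fix p :: "real^3" and vs :: "(real^3) list"
  assume vs: "length vs = 5"
  then have "length (drop 4 vs) = Suc 0"
    by simp
  then obtain u where "drop 4 vs = [u]"
    by (metis length_0_conv length_Suc_conv)
  then show "nabla_R (metric_S \<epsilon>) 1 p vs = 0"
    using nabla_R_metric_M[OF profile_S(1), of vs 1 \<epsilon> p] vs
    by (simp only: metric_S_def nabla_F_1[OF profile_S(1)] profile_S(3) mult_zero_left mult_zero_right minus_zero)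
qed

lemma multilinear_on_zero:
  assumes "multilinear_on V r T" "length vs = r" "set vs \<subseteq> V" "subspace V" "i < r" "vs ! i = 0"
  shows "T vs = 0"
proof -
  have "T (vs[i := 0 *\<^sub>R 0 + 0 *\<^sub>R 0]) = 0 * T (vs[i := 0]) + 0 * T (vs[i := 0])"
    using assms(1-5) subspace_0[OF assms(4)] unfolding multilinear_on_def by blast
  moreover have "vs[i := 0] = vs"
    using assms(6) by (metis list_update_id)
  ultimately show ?thesis
    by simp
qed

lemma area_zero_imp:
  assumes "area v v' \<noteq> 0" "area v w = 0" "area v' w = 0"
  shows "w $ 1 = 0" "w $ 2 = 0"
proof -
  have "w $ 1 * area v v' = v' $ 1 * area v w - v $ 1 * area v' w"
    "w $ 2 * area v v' = v' $ 2 * area v w - v $ 2 * area v' w"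
    by (auto simp: area_def algebra_simps)
  then have "w $ 1 * area v v' = 0" "w $ 2 * area v v' = 0"
    by (simp_all add: assms(2,3))
  then show "w $ 1 = 0" "w $ 2 = 0"
    using assms(1) by (auto simp only: mult_eq_0_iff)
qed

text \<open>If the area form did not vanish on \<open>V\<close>, a vector of \<open>W\<close> would have to be a multiple of
  \<open>e3\<close>; since \<open>g(e3, v)\<close> is the first component of \<open>v\<close>, orthogonality would make \<open>dx\<close> vanish on
  \<open>V\<close>, and the area form with it.\<close>

lemma area_zero_on_summand:
  assumes ort: "\<And>v w. v \<in> V \<Longrightarrow> w \<in> W \<Longrightarrow> ip (metric_M f) p v w = 0"
    and mix: "\<And>v w. v \<in> V \<Longrightarrow> w \<in> W \<Longrightarrow> area v w = 0"
    and W: "subspace W" "W \<noteq> {0}"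
    and v: "v \<in> V" "v' \<in> V"
  shows "area v v' = 0"
proof (rule ccontr)
  assume n: "area v v' \<noteq> 0"
  obtain w where w: "w \<in> W" "w \<noteq> 0"
    using W subspace_0 by blast
  have w12: "w $ 1 = 0" "w $ 2 = 0"
    using area_zero_imp[OF n] mix v w(1) by blast+
  then have "w $ 3 \<noteq> 0"
    using w(2) by (auto simp: vec_eq_iff forall_3)
  then have "v $ 1 = 0" "v' $ 1 = 0"
    using ort[OF v(1) w(1)] ort[OF v(2) w(1)] w12 by (auto simp: ip_metric_M)
  then show False
    using n by (simp add: area_def)
qed

text \<open>In a decomposition the area form would vanish between the summands and also on each of
  them.\<close>

lemma not_decomposable_metric_M:
  assumes f: "smooth_on UNIV f" and "(deriv ^^ 2) f (p $ 2) \<noteq> 0"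
  shows "\<not> decomposable_at (metric_M f) p"
proof
  let ?g = "metric_M f"
  assume "decomposable_at ?g p"
  then show False
    unfolding decomposable_at_def
  proof (elim exE conjE)
    fix V W R1 R2
    assume V: "subspace V" "V \<noteq> {0}" and W: "subspace W" "W \<noteq> {0}"
      and sum: "\<forall>v. \<exists>v1\<in>V. \<exists>v2\<in>W. v = v1 + v2"
      and ort: "\<forall>v\<in>V. \<forall>w\<in>W. ip ?g p v w = 0"
      and R: "multilinear_on V 4 R1" "multilinear_on W 4 R2"
      and split: "\<forall>vs ws. length vs = 4 \<and> length ws = 4 \<and> set vs \<subseteq> V \<and> set ws \<subseteq> W \<longrightarrow>
             curv_tensor ?g p (map2 (+) vs ws) = R1 vs + R2 ws"
    have 0: "0 \<in> V" "0 \<in> W"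
      using V W subspace_0 by blast+
    \<comment> \<open>Inserting both a vector of \<open>V\<close> and one of \<open>W\<close> must give zero, and \<open>R(v,w,v,w)\<close> is
      a nonzero multiple of \<open>(area v w)\<^sup>2\<close>.\<close>
    have mix: "area v w = 0" if v: "v \<in> V" and w: "w \<in> W" for v w
    proof -
      have "R1 [v, 0, v, 0] = 0" "R2 [0, w, 0, w] = 0"
        using multilinear_on_zero[OF R(1), of "[v, 0, v, 0]" 1] multilinear_on_zero[OF R(2), of "[0, w, 0, w]" 0]
          V W v w 0 by auto
      then have "curv_tensor ?g p [v, w, v, w] = 0"
        using split[rule_format, of "[v, 0, v, 0]" "[0, w, 0, w]"] v w 0 by simp
      then show ?thesis
        using assms(2) by (simp add: curv_tensor_metric_M[OF f])
    qed
    obtain v w v' w' where vw: "e1 = v + w" "e2 = v' + w'" "v \<in> V" "v' \<in> V" "w \<in> W" "w' \<in> W"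
      using sum by metis
    have sw: "ip ?g p b a = ip ?g p a b" "area b a = - area a b" for a b
      by (simp_all add: ip_metric_M area_def)
    have ort': "ip ?g p b a = 0" and mix': "area b a = 0" if "a \<in> V" "b \<in> W" for a b
      using ort[rule_format, OF that] mix[OF that] by (simp_all only: sw[of b a])
    have "area v v' = 0"
      by (rule area_zero_on_summand[OF ort[rule_format] mix W vw(3,4)])
    moreover have "area w w' = 0"
      by (rule area_zero_on_summand[OF ort' mix' V vw(5,6)])
    moreover have "area v w' = 0" "area w v' = 0"
      by (simp_all only: mix mix' vw)
    moreover have "area e1 e2 = area v v' + area v w' + area w v' + area w w'"
      unfolding vw(1,2) by (simp add: area_def algebra_simps)
    ultimately show False
      by (simp add: area_def)
  qed
qed

lemma indecomposable_S: "\<epsilon> \<noteq> 0 \<Longrightarrow> indecomposable (metric_S \<epsilon>)"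
  unfolding indecomposable_def metric_S_def
  by (intro allI not_decomposable_metric_M profile_S(1)) (simp add: profile_S(2))

section \<open>Curvature homogeneity\<close>

text \<open>The linear maps that realise the homogeneity of the curvature. They preserve the flag
  \<open>\<langle>e3\<rangle> \<subseteq> \<langle>e2, e3\<rangle>\<close> of kernels of \<open>area_op\<close> and its square. The entry \<open>\<delta>\<close> does not affect the
  curvature and is free to adjust the metric.\<close>

definition scale_shear :: "real \<Rightarrow> real \<Rightarrow> real \<Rightarrow> real \<Rightarrow> real^3 \<Rightarrow> real^3" where
  "scale_shear \<alpha> \<beta> \<gamma> \<delta> v = vector [\<alpha> * v $ 1, \<beta> * v $ 2, \<gamma> * v $ 3 + \<delta> * v $ 1]"

lemma scale_shear_nth [simp]:
  "scale_shear \<alpha> \<beta> \<gamma> \<delta> v $ 1 = \<alpha> * v $ 1"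
  "scale_shear \<alpha> \<beta> \<gamma> \<delta> v $ 2 = \<beta> * v $ 2"
  "scale_shear \<alpha> \<beta> \<gamma> \<delta> v $ 3 = \<gamma> * v $ 3 + \<delta> * v $ 1"
  by (simp_all add: scale_shear_def)

lemma linear_scale_shear: "linear (scale_shear \<alpha> \<beta> \<gamma> \<delta>)"
  by (rule linearI) (simp_all add: vec_eq_iff forall_3 algebra_simps)

lemma bij_scale_shear:
  assumes "\<alpha> \<noteq> 0" "\<beta> \<noteq> 0" "\<gamma> \<noteq> 0"
  shows "bij (scale_shear \<alpha> \<beta> \<gamma> \<delta>)"
proof (rule o_bij)
  let ?L = "scale_shear (1 / \<alpha>) (1 / \<beta>) (1 / \<gamma>) (- \<delta> / (\<alpha> * \<gamma>))"
  show "?L \<circ> scale_shear \<alpha> \<beta> \<gamma> \<delta> = id" "scale_shear \<alpha> \<beta> \<gamma> \<delta> \<circ> ?L = id"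
    using assms by (auto simp: fun_eq_iff vec_eq_iff forall_3 field_simps)
qed

lemma area_scale_shear: "area (scale_shear \<alpha> \<beta> \<gamma> \<delta> u) (scale_shear \<alpha> \<beta> \<gamma> \<delta> v) = \<alpha> * \<beta> * area u v"
  by (simp add: area_def algebra_simps)

text \<open>The second assumption compares the norms of \<open>\<partial>\<^sub>x\<close>, the only metric component that varies.\<close>

lemma linear_isometry_scale_shear:
  assumes "\<alpha> \<noteq> 0" "f (P $ 2) - h (Q $ 2) * \<alpha>\<^sup>2 + \<alpha> * \<delta> = 0"
  shows "linear_isometry (metric_M f) P (metric_M h) Q (scale_shear \<alpha> 1 (1 / \<alpha>) \<delta>)"
proof -
  have "ip (metric_M h) Q (scale_shear \<alpha> 1 (1 / \<alpha>) \<delta> u) (scale_shear \<alpha> 1 (1 / \<alpha>) \<delta> v) - ip (metric_M f) P u v =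
     2 * u $ 1 * v $ 1 * (f (P $ 2) - h (Q $ 2) * \<alpha>\<^sup>2 + \<alpha> * \<delta>)" for u v
    using assms(1) by (simp add: ip_metric_M field_simps power2_eq_square)
  then show ?thesis
    using assms by (simp add: linear_isometry_def linear_scale_shear bij_scale_shear)
qed

lemma zero_curvature_modeled_on_S:
  assumes f: "smooth_on UNIV f" and \<epsilon>: "\<epsilon> \<in> {1, -1}" "\<And>y. sgn ((deriv ^^ 2) f y) = \<epsilon>"
  shows "zero_curvature_modeled_on (metric_M f) (metric_S \<epsilon>)"
  unfolding zero_curvature_modeled_on_def
proof (intro allI)
  fix P Q :: "real^3"
  define F where "F = (deriv ^^ 2) f (P $ 2)"
  define \<alpha> where "\<alpha> = sqrt \<bar>F\<bar>"
  have F: "F \<noteq> 0" "F = \<epsilon> * \<bar>F\<bar>"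
    using \<epsilon>(1) \<epsilon>(2)[of "P $ 2"] sgn_mult_abs[of F] by (auto simp: F_def)
  then have \<alpha>: "\<alpha> \<noteq> 0" "\<epsilon> * \<alpha>\<^sup>2 = F"
    by (auto simp: \<alpha>_def)
  \<comment> \<open>\<open>\<alpha>\<close> matches the curvatures and \<open>\<delta>\<close> the norms of \<open>\<partial>\<^sub>x\<close>.\<close>
  define \<delta> where "\<delta> = (\<epsilon> * (Q $ 2)\<^sup>2 / 2 * \<alpha>\<^sup>2 - f (P $ 2)) / \<alpha>"
  let ?L = "scale_shear \<alpha> 1 (1 / \<alpha>) \<delta>"
  have "linear_isometry (metric_M f) P (metric_S \<epsilon>) Q ?L"
    unfolding metric_S_def by (rule linear_isometry_scale_shear) (use \<alpha>(1) in \<open>simp_all add: \<delta>_def\<close>)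
  moreover have "curv_tensor (metric_S \<epsilon>) Q (map ?L vs) = curv_tensor (metric_M f) P vs"
    if "length vs = 4" for vs
    using that \<alpha>(2) unfolding metric_S_def curv_tensor_metric_M[OF f] curv_tensor_metric_M[OF profile_S(1)]
      profile_S(2)
    by (simp add: area_scale_shear power2_eq_square algebra_simps flip: F_def)
  ultimately show "\<exists>\<phi>. linear_isometry (metric_M f) P (metric_S \<epsilon>) Q \<phi> \<and>
      (\<forall>vs. length vs = 4 \<longrightarrow> curv_tensor (metric_S \<epsilon>) Q (map \<phi> vs) = curv_tensor (metric_M f) P vs)"
    by blast
qed

lemma affine_1_homogeneous:
  assumes f: "smooth_on UNIV f"
    and F: "\<And>y. (deriv ^^ 2) f y \<noteq> 0" "\<And>y. (deriv ^^ 3) f y \<noteq> 0"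
  shows "affine_curvature_homogeneous 1 (metric_M f)"
  unfolding affine_curvature_homogeneous_def
proof (intro allI)
  fix P Q :: "real^3"
  let ?g = "metric_M f"
  define FP where "FP = (deriv ^^ 2) f (P $ 2)"
  define FQ where "FQ = (deriv ^^ 2) f (Q $ 2)"
  define GP where "GP = (deriv ^^ 3) f (P $ 2)"
  define GQ where "GQ = (deriv ^^ 3) f (Q $ 2)"
  have n: "FP \<noteq> 0" "FQ \<noteq> 0" "GP \<noteq> 0" "GQ \<noteq> 0"
    by (simp_all add: FP_def FQ_def GP_def GQ_def F)
  have "sgn FP = sgn FQ"
    unfolding FP_def FQ_def
    by (rule nonvanishing_sgn_const) (auto simp: F intro!: DERIV_isCont[OF deriv_funpow[OF f]])
  then have pos: "FP / FQ > 0"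
    using n by (auto simp: sgn_if divide_neg_neg split: if_splits)
  \<comment> \<open>\<open>\<alpha>\<close> adjusts \<open>f''\<close>, then \<open>\<beta>\<close> adjusts \<open>f'''\<close>, and the factor \<open>\<beta>\<^sup>2 / \<alpha>\<close> on \<open>e3\<close> lets the
    map intertwine \<open>area_op\<close> up to a scalar.\<close>
  define \<alpha> where "\<alpha> = sqrt (FP / FQ)"
  have \<alpha>: "\<alpha> \<noteq> 0" "FQ * \<alpha>\<^sup>2 = FP"
    using pos n by (auto simp: \<alpha>_def)
  define \<beta> where "\<beta> = (GP / FP) / (GQ / FQ)"
  have \<beta>: "\<beta> \<noteq> 0" "GQ * \<beta> * \<alpha>\<^sup>2 = GP"
    using n \<alpha>(2) by (auto simp: \<beta>_def field_simps)
  let ?L = "scale_shear \<alpha> \<beta> (\<beta>\<^sup>2 / \<alpha>) 0"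
  have bij: "bij ?L"
    using \<alpha> \<beta> by (intro bij_scale_shear) auto
  have J: "(\<alpha> * \<beta>) *\<^sub>R area_op (?L v) = \<alpha>\<^sup>2 *\<^sub>R ?L (area_op v)" for v
    using \<alpha>(1) by (auto simp: vec_eq_iff forall_3 power2_eq_square)
  have L_scale: "?L (c *\<^sub>R v) = c *\<^sub>R ?L v" for c v
    by (rule linear_scale[OF linear_scale_shear])
  have j: "nabla_F f i Q (map ?L us) * \<alpha>\<^sup>2 = nabla_F f i P us" if iu: "i \<le> 1" "length us = i" for i us
  proof -
    consider "i = 0" "us = []" | u where "i = 1" "us = [u]"
      using iu by (cases us) auto
    then show ?thesis
    proof cases
      case 1
      then show ?thesis
        using \<alpha>(2) by (simp add: nabla_F_0 FP_def FQ_def)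
    next
      case 2
      then show ?thesis
        by (simp only: list.map nabla_F_1[OF f] scale_shear_nth flip: GP_def GQ_def \<beta>(2)) simp
    qed
  qed
  have "inv ?L (nabla_R_op ?g i Q (map ?L vs)) = nabla_R_op ?g i P vs"
    if i: "i \<le> 1" and vs: "length vs = 3 + i" for i vs
  proof -
    have "nabla_R_op ?g i Q (map ?L vs) =
        (area (vs ! 0) (vs ! 1) * nabla_F f i Q (map ?L (drop 3 vs))) *\<^sub>R ((\<alpha> * \<beta>) *\<^sub>R area_op (?L (vs ! 2)))"
      using vs by (simp add: nabla_R_op_metric_M[OF f] area_scale_shear drop_map)
    also have "\<dots> = (area (vs ! 0) (vs ! 1) * (nabla_F f i Q (map ?L (drop 3 vs)) * \<alpha>\<^sup>2)) *\<^sub>R ?L (area_op (vs ! 2))"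
      unfolding J by simp
    also have "\<dots> = ?L (nabla_R_op ?g i P vs)"
      using vs i by (simp add: j nabla_R_op_metric_M[OF f] L_scale)
    finally show ?thesis
      using bij by (simp add: bij_is_inj)
  qed
  then show "\<exists>\<phi>. linear \<phi> \<and> bij \<phi> \<and> (\<forall>i\<le>1. \<forall>vs. length vs = 3 + i \<longrightarrow>
        inv \<phi> (nabla_R_op ?g i Q (map \<phi> vs)) = nabla_R_op ?g i P vs)"
    using bij linear_scale_shear by blast
qed

lemma curvature_1_homogeneous_of_exp:
  assumes f: "smooth_on UNIV f"
    and F: "\<And>y. (deriv ^^ 2) f y = a * exp (b * y)"
  shows "curvature_homogeneous 1 (metric_M f)"
  unfolding curvature_homogeneous_def
proof (intro allI)
  fix P Q :: "real^3"
  let ?g = "metric_M f"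
  define \<alpha> where "\<alpha> = exp (- b * (Q $ 2 - P $ 2) / 2)"
  define \<delta> where "\<delta> = (f (Q $ 2) * \<alpha>\<^sup>2 - f (P $ 2)) / \<alpha>"
  have "\<alpha>\<^sup>2 = exp (- b * (Q $ 2 - P $ 2))"
    unfolding \<alpha>_def power2_eq_square mult_exp_exp by simp
  then have \<alpha>: "\<alpha> \<noteq> 0" "exp (b * Q $ 2) * \<alpha>\<^sup>2 = exp (b * P $ 2)"
    by (simp_all add: \<alpha>_def mult_exp_exp algebra_simps)
  have "deriv ((deriv ^^ 2) f) y = a * b * exp (b * y)" for y
    unfolding ext[of "(deriv ^^ 2) f", OF F]
    by (rule DERIV_imp_deriv) (auto intro!: derivative_eq_intros)
  then have F': "(deriv ^^ 3) f y = a * b * exp (b * y)" for y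
    by (simp add: numeral_eq_Suc)
  let ?L = "scale_shear \<alpha> 1 (1 / \<alpha>) \<delta>"
  have iso: "linear_isometry ?g P ?g Q ?L"
    by (rule linear_isometry_scale_shear) (use \<alpha>(1) in \<open>simp_all add: \<delta>_def\<close>)
  have j: "\<alpha>\<^sup>2 * nabla_F f i Q (map ?L us) = nabla_F f i P us" if iu: "i \<le> 1" "length us = i" for i us
  proof -
    consider "i = 0" "us = []" | u where "i = 1" "us = [u]"
      using iu by (cases us) auto
    then show ?thesis
    proof cases
      case 1
      then show ?thesis
        by (simp add: nabla_F_0 F flip: \<alpha>(2))
    next
      case 2
      then show ?thesis
        by (simp only: list.map nabla_F_1[OF f] F') (simp add: mult_ac flip: \<alpha>(2))
    qed
  qed
  have "nabla_R ?g i Q (map ?L vs) = nabla_R ?g i P vs" if "i \<le> 1" "length vs = 4 + i" for i vs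
    using that by (simp add: nabla_R_metric_M[OF f] area_scale_shear drop_map power2_eq_square mult_ac flip: j)
  then show "\<exists>\<phi>. linear_isometry ?g P ?g Q \<phi> \<and>
     (\<forall>i\<le>1. \<forall>vs. length vs = 4 + i \<longrightarrow> nabla_R ?g i Q (map \<phi> vs) = nabla_R ?g i P vs)"
    using iso by blast
qed

text \<open>Lowering an index with a metric that the map preserves turns the operator into the tensor.\<close>

lemma nabla_R_op_isometry:
  assumes f: "smooth_on UNIV f" and "linear_isometry (metric_M f) P (metric_M f) Q \<phi>"
    and R: "\<And>vs. length vs = 4 + i \<Longrightarrow> nabla_R (metric_M f) i Q (map \<phi> vs) = nabla_R (metric_M f) i P vs"
    and vs: "length vs = 3 + i"
  shows "inv \<phi> (nabla_R_op (metric_M f) i Q (map \<phi> vs)) = nabla_R_op (metric_M f) i P vs"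
proof -
  let ?g = "metric_M f"
  have \<phi>: "bij \<phi>" "\<And>u v. ip ?g Q (\<phi> u) (\<phi> v) = ip ?g P u v"
    using assms(2) unfolding linear_isometry_def by blast+
  obtain v0 v1 v2 us where vs_eq: "vs = v0 # v1 # v2 # us" and us: "length us = i"
    using vs by (auto simp: length_Suc_conv numeral_3_eq_3)
  have op: "ip ?g p (nabla_R_op ?g i p (a # b # c # xs)) z = nabla_R ?g i p (a # b # c # z # xs)"
    if "length xs = i" for p a b c z xs
  proof -
    have "ip ?g p (x *\<^sub>R area_op c) z = x * - area c z" for x
      by (simp add: ip_metric_M area_def algebra_simps)
    then show ?thesis
      using that by (simp add: nabla_R_metric_M[OF f] nabla_R_op_metric_M[OF f])
  qed
  have "ip ?g Q (nabla_R_op ?g i Q (map \<phi> vs)) (\<phi> w) = ip ?g Q (\<phi> (nabla_R_op ?g i P vs)) (\<phi> w)" for w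
  proof -
    have "ip ?g Q (nabla_R_op ?g i Q (map \<phi> vs)) (\<phi> w) = nabla_R ?g i Q (map \<phi> (v0 # v1 # v2 # w # us))"
      using us by (simp add: vs_eq op)
    also have "\<dots> = nabla_R ?g i P (v0 # v1 # v2 # w # us)"
      using us by (intro R) simp
    also have "\<dots> = ip ?g P (nabla_R_op ?g i P vs) w"
      using us by (simp add: vs_eq op)
    finally show ?thesis
      by (simp add: \<phi>(2))
  qed
  then have "nabla_R_op ?g i Q (map \<phi> vs) = \<phi> (nabla_R_op ?g i P vs)"
    by (intro ip_metric_M_nondegenerate[of f Q]) (metis \<phi>(1) bij_pointE)
  then show ?thesis
    using \<phi>(1) by (simp add: bij_is_inj)
qed

lemma curvature_homogeneous_imp_affine:
  assumes f: "smooth_on UNIV f" and "curvature_homogeneous k (metric_M f)"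
  shows "affine_curvature_homogeneous k (metric_M f)"
  unfolding affine_curvature_homogeneous_def
proof (intro allI)
  fix P Q :: "real^3"
  let ?g = "metric_M f"
  obtain \<phi> where iso: "linear_isometry ?g P ?g Q \<phi>"
    and R: "\<And>i vs. i \<le> k \<Longrightarrow> length vs = 4 + i \<Longrightarrow> nabla_R ?g i Q (map \<phi> vs) = nabla_R ?g i P vs"
    using assms(2) unfolding curvature_homogeneous_def by metis
  then have "linear \<phi>" "bij \<phi>"
    by (simp_all add: linear_isometry_def)
  then show "\<exists>\<phi>. linear \<phi> \<and> bij \<phi> \<and> (\<forall>i\<le>k. \<forall>vs. length vs = 3 + i \<longrightarrow>
        inv \<phi> (nabla_R_op ?g i Q (map \<phi> vs)) = nabla_R_op ?g i P vs)"
    using nabla_R_op_isometry[OF f iso R] by blast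
qed

text \<open>Evaluating the intertwining relation of order zero with \<open>e1, e2\<close> in the first two
  arguments shows that \<open>\<phi>\<close> intertwines \<open>area_op\<close> up to a scalar \<open>\<mu>\<close>. This makes \<open>\<phi>\<close> triangular,
  with \<open>\<beta> = \<mu> \<alpha>\<close>. Therefore \<open>area (\<phi> e1) (\<phi> e2) = \<alpha> \<beta> = \<mu> \<alpha>\<^sup>2\<close>, and after cancelling \<open>\<mu>\<close> each
  higher relation becomes one between the covariant derivatives of the function \<open>f''\<close>.\<close>

lemma affine_curvature_map:
  assumes f: "smooth_on UNIV f"
    and F: "(deriv ^^ 2) f (P $ 2) \<noteq> 0" "(deriv ^^ 2) f (Q $ 2) \<noteq> 0"
    and \<phi>: "linear \<phi>" "bij \<phi>"
    and R: "\<And>i vs. i \<le> k \<Longrightarrow> length vs = 3 + i \<Longrightarrow>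
      inv \<phi> (nabla_R_op (metric_M f) i Q (map \<phi> vs)) = nabla_R_op (metric_M f) i P vs"
  obtains \<alpha> \<beta> where "\<alpha> \<noteq> 0" "\<beta> \<noteq> 0"
    and "\<phi> e1 $ 1 = \<alpha>" "\<phi> e2 $ 1 = 0" "\<phi> e2 $ 2 = \<beta>"
    and "\<And>i us. i \<le> k \<Longrightarrow> length us = i \<Longrightarrow> \<alpha>\<^sup>2 * nabla_F f i Q (map \<phi> us) = nabla_F f i P us"
proof -
  let ?g = "metric_M f"
  have inj: "\<phi> v = 0 \<longleftrightarrow> v = 0" for v
    using \<phi> linear_injective_0 linear_0 bij_is_inj by metis
  have E: "(area (\<phi> e1) (\<phi> e2) * nabla_F f i Q (map \<phi> us)) *\<^sub>R area_op (\<phi> v) = nabla_F f i P us *\<^sub>R \<phi> (area_op v)"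
    if "i \<le> k" "length us = i" for i us v
  proof -
    have "nabla_R_op ?g i Q (map \<phi> ([e1, e2, v] @ us)) = \<phi> (nabla_R_op ?g i P ([e1, e2, v] @ us))"
    proof -
      have "inv \<phi> (nabla_R_op ?g i Q (map \<phi> ([e1, e2, v] @ us))) = nabla_R_op ?g i P ([e1, e2, v] @ us)"
        using that by (intro R) simp_all
      then show ?thesis
        using surj_f_inv_f[OF bij_is_surj[OF \<phi>(2)]] by metis
    qed
    moreover have "area e1 e2 = 1"
      by (simp add: area_def)
    ultimately show ?thesis
      using that by (simp add: nabla_R_op_metric_M[OF f] linear_scale[OF \<phi>(1)])
  qed
  define \<mu> where "\<mu> = area (\<phi> e1) (\<phi> e2) * (deriv ^^ 2) f (Q $ 2) / (deriv ^^ 2) f (P $ 2)"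
  have "(area (\<phi> e1) (\<phi> e2) * (deriv ^^ 2) f (Q $ 2)) *\<^sub>R area_op (\<phi> v) =
      (deriv ^^ 2) f (P $ 2) *\<^sub>R \<phi> (area_op v)" for v
    using E[of 0 "[]" v] by (simp add: nabla_F_0)
  then have "(1 / (deriv ^^ 2) f (P $ 2)) *\<^sub>R (area (\<phi> e1) (\<phi> e2) * (deriv ^^ 2) f (Q $ 2)) *\<^sub>R area_op (\<phi> v) =
      (1 / (deriv ^^ 2) f (P $ 2)) *\<^sub>R (deriv ^^ 2) f (P $ 2) *\<^sub>R \<phi> (area_op v)" for v
    by simp
  then have \<mu>: "\<mu> *\<^sub>R area_op (\<phi> v) = \<phi> (area_op v)" for v
    using F(1) by (simp add: \<mu>_def)
  have ax: "area_op e1 = - e2" "area_op e2 = e3" "area_op e3 = 0"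
    by (simp_all add: vec_eq_iff forall_3)
  have e_nz: "e2 \<noteq> 0" "e3 \<noteq> 0"
    by (auto simp: vec_eq_iff forall_3)
  define \<alpha> where "\<alpha> = \<phi> e1 $ 1"
  define \<beta> where "\<beta> = \<phi> e2 $ 2"
  have neg: "\<phi> (- e2) = - \<phi> e2"
    by (rule linear_neg[OF \<phi>(1)])
  \<comment> \<open>The intertwining relation on \<open>e2\<close> and \<open>e1\<close> determines the shape of \<open>\<phi>\<close>.\<close>
  have 3: "\<mu> * - \<phi> e2 $ 1 = \<phi> e3 $ 2" "\<mu> * \<beta> = \<phi> e3 $ 3" "\<phi> e3 $ 1 = 0"
    using \<mu>[of e2] by (auto simp: ax \<beta>_def vec_eq_iff forall_3)
  have 2: "\<mu> * \<alpha> = \<beta>" "\<phi> e2 $ 1 = 0"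
    using \<mu>[of e1] by (auto simp: ax neg \<alpha>_def \<beta>_def vec_eq_iff forall_3)
  have "\<phi> e3 \<noteq> 0"
    using inj e_nz by blast
  then have nz: "\<mu> \<noteq> 0" "\<beta> \<noteq> 0" "\<alpha> \<noteq> 0"
    using 2 3 by (auto simp: vec_eq_iff forall_3)
  have a: "area (\<phi> e1) (\<phi> e2) = \<mu> * \<alpha>\<^sup>2"
    using 2 by (simp add: area_def \<alpha>_def \<beta>_def power2_eq_square mult_ac)
  have "\<alpha>\<^sup>2 * nabla_F f i Q (map \<phi> us) = nabla_F f i P us" if "i \<le> k" "length us = i" for i us
  proof -
    have "\<phi> e3 = \<mu> *\<^sub>R area_op (\<phi> e2)"
      by (simp add: \<mu> ax)
    then have "(\<alpha>\<^sup>2 * nabla_F f i Q (map \<phi> us)) *\<^sub>R \<phi> e3 =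
        (\<mu> * \<alpha>\<^sup>2 * nabla_F f i Q (map \<phi> us)) *\<^sub>R area_op (\<phi> e2)"
      by (simp add: mult_ac)
    also have "\<dots> = nabla_F f i P us *\<^sub>R \<phi> e3"
      using E[OF that, of e2] by (simp only: a ax)
    finally have "(\<alpha>\<^sup>2 * nabla_F f i Q (map \<phi> us)) *\<^sub>R \<phi> e3 = nabla_F f i P us *\<^sub>R \<phi> e3" .
    then show ?thesis
      using \<open>\<phi> e3 \<noteq> 0\<close> by simp
  qed
  then show thesis
    by (rule that[OF nz(3,2) \<alpha>_def[symmetric] 2(2) \<beta>_def[symmetric]])
qed

text \<open>An isometry has \<open>\<beta>\<^sup>2 = 1\<close>, so the factor \<open>\<beta>\<close> by which it changes \<open>f''' / f''\<close> is a sign.\<close>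

lemma curvature_1_homogeneous_imp_exp:
  assumes f: "smooth_on UNIV f"
    and F: "\<And>y. (deriv ^^ 2) f y \<noteq> 0" "\<And>y. (deriv ^^ 3) f y \<noteq> 0"
    and hom: "curvature_homogeneous 1 (metric_M f)"
  shows "\<exists>a b. \<forall>y. (deriv ^^ 2) f y = a * exp (b * y)"
proof (rule third_over_second_const_imp_exp[OF f F])
  fix x y :: real
  let ?g = "metric_M f" and ?P = "x *\<^sub>R e2" and ?Q = "y *\<^sub>R e2"
  obtain \<phi> where iso: "linear_isometry ?g ?P ?g ?Q \<phi>"
    and R: "\<And>i vs. i \<le> 1 \<Longrightarrow> length vs = 4 + i \<Longrightarrow> nabla_R ?g i ?Q (map \<phi> vs) = nabla_R ?g i ?P vs"
    using hom unfolding curvature_homogeneous_def by metis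
  have \<phi>: "linear \<phi>" "bij \<phi>" "ip ?g ?Q (\<phi> e2) (\<phi> e2) = ip ?g ?P e2 e2"
    using iso unfolding linear_isometry_def by blast+
  obtain \<alpha> \<beta> where \<alpha>: "\<alpha> \<noteq> 0" and e2: "\<phi> e2 $ 1 = 0" "\<phi> e2 $ 2 = \<beta>"
    and rel: "\<And>i us. i \<le> 1 \<Longrightarrow> length us = i \<Longrightarrow> \<alpha>\<^sup>2 * nabla_F f i ?Q (map \<phi> us) = nabla_F f i ?P us"
    by (rule affine_curvature_map[OF f F(1) F(1) \<phi>(1,2) nabla_R_op_isometry[OF f iso R]]) blast+
  have \<beta>: "\<beta>\<^sup>2 = 1"
    using \<phi>(3) by (simp add: ip_metric_M e2 power2_eq_square)
  have 0: "\<alpha>\<^sup>2 * (deriv ^^ 2) f y = (deriv ^^ 2) f x"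
    using rel[of 0 "[]"] by (simp add: nabla_F_0)
  have 1: "\<alpha>\<^sup>2 * ((deriv ^^ 3) f y * \<beta>) = (deriv ^^ 3) f x"
    using rel[of 1 "[e2]"] by (simp only: list.map nabla_F_1[OF f]) (simp add: e2)
  show "((deriv ^^ 3) f x / (deriv ^^ 2) f x)\<^sup>2 = ((deriv ^^ 3) f y / (deriv ^^ 2) f y)\<^sup>2"
    unfolding 0[symmetric] 1[symmetric] using \<alpha> by (simp add: power_divide power_mult_distrib \<beta>)
qed

text \<open>Order one forces \<open>\<phi> e1\<close> to have no component along \<open>e2\<close>. The second order relation on
  \<open>(e1, e1)\<close> then compares \<open>f' f'''\<close> at the two points with factor \<open>\<alpha>\<^sup>4\<close>, while \<open>f''\<close> has factor
  \<open>\<alpha>\<^sup>2\<close>.\<close>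

lemma affine_2_homogeneous_imp_exp:
  assumes f: "smooth_on UNIV f"
    and F: "\<And>y. (deriv ^^ 2) f y \<noteq> 0" "\<And>y. (deriv ^^ 3) f y \<noteq> 0"
    and hom: "affine_curvature_homogeneous 2 (metric_M f)"
  shows "\<exists>a b. \<forall>y. deriv f y = a * exp (b * y)"
proof (rule ratio_const_imp_exp[OF f F])
  fix x y :: real
  let ?g = "metric_M f" and ?P = "x *\<^sub>R e2" and ?Q = "y *\<^sub>R e2"
  obtain \<phi> where \<phi>: "linear \<phi>" "bij \<phi>"
    and R: "\<And>i vs. i \<le> 2 \<Longrightarrow> length vs = 3 + i \<Longrightarrow>
        inv \<phi> (nabla_R_op ?g i ?Q (map \<phi> vs)) = nabla_R_op ?g i ?P vs"
    using hom unfolding affine_curvature_homogeneous_def by metis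
  obtain \<alpha> where \<alpha>: "\<alpha> \<noteq> 0" "\<phi> e1 $ 1 = \<alpha>"
    and rel: "\<And>i us. i \<le> 2 \<Longrightarrow> length us = i \<Longrightarrow> \<alpha>\<^sup>2 * nabla_F f i ?Q (map \<phi> us) = nabla_F f i ?P us"
    by (rule affine_curvature_map[OF f F(1) F(1) \<phi> R]) blast+
  have 0: "\<alpha>\<^sup>2 * (deriv ^^ 2) f y = (deriv ^^ 2) f x"
    using rel[of 0 "[]"] by (simp add: nabla_F_0)
  have 1: "\<phi> e1 $ 2 = 0"
    using rel[of 1 "[e1]"] \<alpha>(1) F(2)[of y] by (simp only: list.map nabla_F_1[OF f]) simp
  have 2: "\<alpha>\<^sup>2 * (\<alpha>\<^sup>2 * (deriv f y * (deriv ^^ 3) f y)) = deriv f x * (deriv ^^ 3) f x"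
    using rel[of 2 "[e1, e1]"] by (simp add: nabla_F_2[OF f] 1 \<alpha>(2) power2_eq_square algebra_simps)
  show "deriv f x * (deriv ^^ 3) f x / ((deriv ^^ 2) f x)\<^sup>2 = deriv f y * (deriv ^^ 3) f y / ((deriv ^^ 2) f y)\<^sup>2"
    unfolding 0[symmetric] 2[symmetric] using \<alpha>(1) F(1)[of y] by (simp add: field_simps power2_eq_square)
qed

section \<open>Isometries in the exponential case\<close>

text \<open>A translation by \<open>t\<close> in \<open>y\<close> multiplies \<open>f'\<close>, and with it \<open>f''\<close>, by \<open>\<alpha>\<^sup>-\<^sup>2\<close>. In each
  further covariant derivative this factor of \<open>f'\<close> is compensated by the factors \<open>\<alpha>\<close> of the two
  first components that accompany \<open>f'\<close>.\<close>

lemma nabla_F_scale_shear: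
  assumes f: "smooth_on UNIV f"
    and f': "\<And>y. deriv f (y + t) * \<alpha>\<^sup>2 = deriv f y"
    and "length vs = k"
  shows "\<alpha>\<^sup>2 * nabla_F f k ((y + t) *\<^sub>R e2) (map (scale_shear \<alpha> 1 \<gamma> \<delta>) vs) = nabla_F f k (y *\<^sub>R e2) vs"
  using assms(3)
proof (induction k arbitrary: y vs)
  case 0
  have "((\<lambda>y. deriv f (y + t) * \<alpha>\<^sup>2) has_real_derivative (deriv ^^ 2) f (y + t) * \<alpha>\<^sup>2) (at y)"
    using DERIV_shift[of "deriv f" "(deriv ^^ 2) f (y + t)" y t] deriv_1_smooth[OF f]
    by (intro DERIV_cmult_right) simp
  then have "(deriv ^^ 2) f (y + t) * \<alpha>\<^sup>2 = (deriv ^^ 2) f y"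
    unfolding f' by (rule DERIV_unique[OF _ deriv_1_smooth[OF f]])
  then show ?case
    by (simp add: nabla_F_0 mult.commute)
next
  case (Suc k)
  then obtain ws u where vs: "vs = ws @ [u]" and r: "length ws = k"
    by (metis length_Suc_conv_rev)
  let ?L = "scale_shear \<alpha> 1 \<gamma> \<delta>"
  let ?D = "\<lambda>ws y. deriv (\<lambda>y. nabla_F f k (y *\<^sub>R e2) ws) y"
  note T = profile_tensor_nabla_F[OF f, of k]
  have r': "length (map ?L ws) = k"
    by (simp add: r)
  have "((\<lambda>y. \<alpha>\<^sup>2 * nabla_F f k ((y + t) *\<^sub>R e2) (map ?L ws)) has_real_derivative
      \<alpha>\<^sup>2 * ?D (map ?L ws) (y + t)) (at y)"
    using DERIV_shift[of "\<lambda>y. nabla_F f k (y *\<^sub>R e2) (map ?L ws)" "?D (map ?L ws) (y + t)" y t]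
      profile_tensor_frechet(2)[OF f T r']
    by (intro DERIV_cmult) simp
  then have D: "\<alpha>\<^sup>2 * ?D (map ?L ws) (y + t) = ?D ws y"
    unfolding Suc.IH[OF r] by (rule DERIV_unique[OF _ profile_tensor_frechet(2)[OF f T r]])
  have "?L e2 = e2"
    by (simp add: vec_eq_iff forall_3)
  then have S: "\<alpha>\<^sup>2 * nabla_F f k ((y + t) *\<^sub>R e2) ((map ?L ws)[i := e2]) = nabla_F f k (y *\<^sub>R e2) (ws[i := e2])" for i
    using Suc.IH[of "ws[i := e2]" y] r by (simp add: map_update)
  have "\<alpha>\<^sup>2 * nabla_F f (Suc k) ((y + t) *\<^sub>R e2) (map ?L vs) =
      u $ 2 * (\<alpha>\<^sup>2 * ?D (map ?L ws) (y + t)) - (\<Sum>i<k. (deriv f (y + t) * \<alpha>\<^sup>2) * u $ 1 *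
        (ws ! i $ 1 * (\<alpha>\<^sup>2 * nabla_F f k ((y + t) *\<^sub>R e2) ((map ?L ws)[i := e2]))))"
    unfolding nabla_F_Suc vs map_append list.map cov_deriv_profile[OF f T r'] right_diff_distrib sum_distrib_left
    by (intro arg_cong2[of _ _ _ _ "(-)"] sum.cong) (simp_all add: r power2_eq_square mult_ac)
  also have "\<dots> = nabla_F f (Suc k) (y *\<^sub>R e2) vs"
    unfolding D S f' nabla_F_Suc vs cov_deriv_profile[OF f T r] by simp
  finally show ?case .
qed

text \<open>For \<open>f' = a e\<^sup>b\<^sup>y\<close> one takes \<open>\<alpha> = exp (- b t / 2)\<close>. The last property then holds with a
  \<open>\<delta>\<close> independent of \<open>y\<close>, because its derivative with respect to \<open>y\<close> is the second one.\<close>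

lemma exp_scale_shear:
  fixes f :: "real \<Rightarrow> real"
  assumes f: "smooth_on UNIV f" and f': "\<And>y. deriv f y = a * exp (b * y)"
  obtains \<alpha> \<delta> where "\<alpha> \<noteq> 0" "\<And>y. deriv f (y + t) * \<alpha>\<^sup>2 = deriv f y"
    "\<And>y. f y - f (y + t) * \<alpha>\<^sup>2 + \<alpha> * \<delta> = 0"
proof -
  define \<alpha> where "\<alpha> = exp (- b * t / 2)"
  define \<delta> where "\<delta> = (f t * \<alpha>\<^sup>2 - f 0) / \<alpha>"
  have "\<alpha>\<^sup>2 = exp (- b * t)"
    unfolding \<alpha>_def power2_eq_square mult_exp_exp by simp
  then have \<alpha>: "\<alpha> \<noteq> 0" "deriv f (y + t) * \<alpha>\<^sup>2 = deriv f y" for y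
    by (simp_all add: \<alpha>_def f' mult_exp_exp algebra_simps)
  have "((\<lambda>y. f y - f (y + t) * \<alpha>\<^sup>2) has_real_derivative deriv f y - deriv f (y + t) * \<alpha>\<^sup>2) (at y)" for y
    using DERIV_shift[of f "deriv f (y + t)" y t] deriv_smooth(1)[OF f]
    by (intro DERIV_diff DERIV_cmult_right) simp_all
  then have "((\<lambda>y. f y - f (y + t) * \<alpha>\<^sup>2) has_real_derivative 0) (at y)" for y
    by (simp add: \<alpha>(2))
  then have "f y - f (y + t) * \<alpha>\<^sup>2 = f 0 - f (0 + t) * \<alpha>\<^sup>2" for y
    by (rule DERIV_isconst_all[rule_format])
  then have "f y - f (y + t) * \<alpha>\<^sup>2 + \<alpha> * \<delta> = 0" for y
    using \<alpha>(1) by (simp add: \<delta>_def)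
  then show thesis
    by (rule that[OF \<alpha>])
qed

lemma curvature_homogeneous_of_exp:
  assumes f: "smooth_on UNIV f" and f': "\<And>y. deriv f y = a * exp (b * y)"
  shows "curvature_homogeneous k (metric_M f)"
  unfolding curvature_homogeneous_def
proof (intro allI)
  fix P Q :: "real^3"
  let ?g = "metric_M f"
  obtain \<alpha> \<delta> where \<alpha>: "\<alpha> \<noteq> 0" "\<And>y. deriv f (y + (Q $ 2 - P $ 2)) * \<alpha>\<^sup>2 = deriv f y"
    and \<delta>: "\<And>y. f y - f (y + (Q $ 2 - P $ 2)) * \<alpha>\<^sup>2 + \<alpha> * \<delta> = 0"
    by (rule exp_scale_shear[OF f f', of "Q $ 2 - P $ 2"]) blast
  let ?L = "scale_shear \<alpha> 1 (1 / \<alpha>) \<delta>"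
  have iso: "linear_isometry ?g P ?g Q ?L"
    by (rule linear_isometry_scale_shear[OF \<alpha>(1)]) (use \<delta>[of "P $ 2"] in simp)
  have j: "\<alpha>\<^sup>2 * nabla_F f i Q (map ?L us) = nabla_F f i P us" if "length us = i" for i us
    using nabla_F_scale_shear[OF f \<alpha>(2) that, of "P $ 2"] that
    by (simp add: nabla_F_depends_on_y[OF f, of _ i P] nabla_F_depends_on_y[OF f, of _ i Q])
  have "nabla_R ?g i Q (map ?L vs) = nabla_R ?g i P vs" if "length vs = 4 + i" for i vs
    using that by (simp add: nabla_R_metric_M[OF f] area_scale_shear drop_map power2_eq_square mult_ac flip: j)
  then show "\<exists>\<phi>. linear_isometry ?g P ?g Q \<phi> \<and>
     (\<forall>i\<le>k. \<forall>vs. length vs = 4 + i \<longrightarrow> nabla_R ?g i Q (map \<phi> vs) = nabla_R ?g i P vs)"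
    using iso by blast
qed

lemma has_derivative_affine:
  fixes L :: "'a::euclidean_space \<Rightarrow> 'b::real_normed_vector"
  assumes "linear L"
  shows "((\<lambda>q. c + L q) has_derivative L) (at p)"
proof -
  have "bounded_linear L"
    using assms linear_conv_bounded_linear by blast
  from has_derivative_add[OF has_derivative_const bounded_linear_imp_has_derivative[OF this]]
  show ?thesis
    by simp
qed

lemma smooth_affine:
  fixes L :: "'a::euclidean_space \<Rightarrow> 'b::real_normed_vector"
  assumes "linear L"
  shows "smooth_on UNIV (\<lambda>q. c + L q)"
proof -
  have bl: "bounded_linear L"
    using assms linear_conv_bounded_linear by blast
  have const: "Ck_on k UNIV (\<lambda>_::'a. d)" for k and d :: 'b
  proof (induction k arbitrary: d)
    case (Suc k)
    then show ?case
      by simp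
  qed simp
  note d = has_derivative_affine[OF assms]
  have "Ck_on k UNIV (\<lambda>q. c + L q)" for k
  proof (cases k)
    case 0
    then show ?thesis
      using linear_continuous_on[OF bl, of UNIV] by (auto intro!: continuous_on_add)
  next
    case (Suc n)
    then show ?thesis
      using d const by (auto simp: differentiable_def simp flip: frechet_derivative_at[OF d])
  qed
  then show ?thesis
    by (simp add: smooth_on_def)
qed

text \<open>The affine map with linear part \<open>scale_shear\<close> that takes \<open>P\<close> to \<open>Q\<close> is a global isometry.\<close>

lemma locally_homogeneous_of_exp:
  assumes f: "smooth_on UNIV f" and f': "\<And>y. deriv f y = a * exp (b * y)"
  shows "locally_homogeneous (metric_M f)"
  unfolding locally_homogeneous_def
proof (intro allI)
  fix P Q :: "real^3"
  let ?g = "metric_M f"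
  obtain \<alpha> \<delta> where \<alpha>: "\<alpha> \<noteq> 0"
    and \<delta>: "\<And>y. f y - f (y + (Q $ 2 - P $ 2)) * \<alpha>\<^sup>2 + \<alpha> * \<delta> = 0"
    by (rule exp_scale_shear[OF f f', of "Q $ 2 - P $ 2"]) blast
  let ?L = "scale_shear \<alpha> 1 (1 / \<alpha>) \<delta>"
  let ?M = "inv ?L"
  define \<Phi> where "\<Phi> p = (Q - ?L P) + ?L p" for p
  define \<Psi> where "\<Psi> q = (P - ?M Q) + ?M q" for q
  have bij: "bij ?L"
    using \<alpha> by (simp add: bij_scale_shear)
  have LM: "?L (?M v) = v" "?M (?L v) = v" for v
    using bij by (simp_all add: bij_is_inj bij_is_surj surj_f_inv_f)
  have linM: "linear ?M"
    using linear_scale_shear bij inj_linear_imp_inv_linear bij_is_inj by blast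
  note L_simps = linear_add[OF linear_scale_shear] linear_diff[OF linear_scale_shear]
  note M_simps = linear_add[OF linM] linear_diff[OF linM]
  have inv: "\<Psi> (\<Phi> p) = p" "\<Phi> (\<Psi> q) = q" for p q
    unfolding \<Phi>_def \<Psi>_def by (simp_all only: L_simps M_simps LM) simp_all
  then have bij\<Phi>: "bij \<Phi>"
    by (intro o_bij[of \<Psi>]) (auto simp: fun_eq_iff)
  have inv\<Phi>: "inv_into UNIV \<Phi> = \<Psi>"
    using inv by (intro inv_equality) 
  have d: "frechet_derivative \<Phi> (at p) = ?L" for p
    unfolding \<Phi>_def[abs_def] by (rule frechet_derivative_at[OF has_derivative_affine[OF linear_scale_shear], symmetric])
  have "ip ?g (\<Phi> p) (?L u) (?L v) = ip ?g p u v" for p u v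
    using linear_isometry_scale_shear[OF \<alpha>, of f p f "\<Phi> p" \<delta>] \<delta>[of "p $ 2"]
    by (simp add: linear_isometry_def \<Phi>_def algebra_simps)
  moreover have "smooth_on UNIV \<Phi>" "smooth_on UNIV \<Psi>"
    unfolding \<Phi>_def[abs_def] \<Psi>_def[abs_def] by (intro smooth_affine linear_scale_shear linM)+
  ultimately have "isometry_between ?g ?g UNIV UNIV \<Phi>"
    using bij\<Phi> by (simp add: isometry_between_def inv\<Phi> d)
  moreover have "\<Phi> P = Q"
    by (simp add: \<Phi>_def)
  ultimately show "\<exists>U V \<Phi>. open U \<and> P \<in> U \<and> open V \<and> Q \<in> V \<and>
     isometry_between ?g ?g U V \<Phi> \<and> \<Phi> P = Q"
    by (intro exI[of _ UNIV] exI[of _ \<Phi>]) simp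
qed

section \<open>Symmetry of second derivatives\<close>

text \<open>The mean value theorem, applied once in each direction.\<close>

lemma second_difference_mean_value:
  fixes h :: "'a::real_normed_vector \<Rightarrow> real"
  assumes h: "\<And>q. q \<in> ball p e \<Longrightarrow> (h has_derivative h' q) (at q)"
    and hu: "\<And>q. q \<in> ball p e \<Longrightarrow> ((\<lambda>q. h' q u) has_derivative hu q) (at q)"
    and t: "0 < t" "t * (norm u + norm v) < e"
  shows "\<exists>z. dist z p \<le> t * (norm u + norm v) \<and>
    h (p + t *\<^sub>R u + t *\<^sub>R v) - h (p + t *\<^sub>R u) - h (p + t *\<^sub>R v) + h p = t * (t * hu z v)"
proof -
  have near: "dist (p + s *\<^sub>R u + s' *\<^sub>R v) p \<le> t * (norm u + norm v)"
    if "0 \<le> s" "s \<le> t" "0 \<le> s'" "s' \<le> t" for s s'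
  proof -
    have "dist (p + s *\<^sub>R u + s' *\<^sub>R v) p \<le> norm (s *\<^sub>R u) + norm (s' *\<^sub>R v)"
      unfolding dist_norm by (metis add.assoc add_diff_cancel_left' norm_triangle_ineq)
    also have "\<dots> \<le> t * norm u + t * norm v"
      using that by (intro add_mono) (auto intro: mult_right_mono)
    finally show ?thesis
      by (simp add: distrib_left)
  qed
  have in_ball: "p + s *\<^sub>R u + s' *\<^sub>R v \<in> ball p e"
    if "0 \<le> s" "s \<le> t" "0 \<le> s'" "s' \<le> t" for s s'
    using near[OF that] t(2) by (simp add: dist_commute)
  have line: "((\<lambda>s. G (c + s *\<^sub>R w)) has_real_derivative G' w) (at s)"
    if "(G has_derivative G') (at (c + s *\<^sub>R w))" for G :: "'a \<Rightarrow> real" and G' c w s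
  proof -
    have "((\<lambda>s. c + s *\<^sub>R w) has_derivative (\<lambda>r. r *\<^sub>R w)) (at s)"
      by (auto intro!: derivative_eq_intros)
    from has_derivative_compose[OF this that]
    have "((\<lambda>s. G (c + s *\<^sub>R w)) has_derivative (\<lambda>r. G' (r *\<^sub>R w))) (at s)" .
    moreover have "(\<lambda>r. G' (r *\<^sub>R w)) = (*) (G' w)"
      using linear_scale[OF has_derivative_linear[OF that]] by (simp add: fun_eq_iff mult.commute)
    ultimately show ?thesis
      by (simp add: has_field_derivative_def)
  qed
  have "\<exists>\<xi>>0. \<xi> < t \<and> (h (p + t *\<^sub>R v + t *\<^sub>R u) - h (p + t *\<^sub>R u)) - (h (p + t *\<^sub>R v + 0 *\<^sub>R u) - h (p + 0 *\<^sub>R u))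
      = (t - 0) * (h' (p + t *\<^sub>R v + \<xi> *\<^sub>R u) u - h' (p + \<xi> *\<^sub>R u) u)"
  proof (rule MVT2[OF t(1)])
    fix s assume s: "0 \<le> s" "s \<le> t"
    show "((\<lambda>s. h (p + t *\<^sub>R v + s *\<^sub>R u) - h (p + s *\<^sub>R u)) has_real_derivative
        h' (p + t *\<^sub>R v + s *\<^sub>R u) u - h' (p + s *\<^sub>R u) u) (at s)"
      using in_ball[OF s, of t] in_ball[OF s, of 0] t(1)
      by (intro DERIV_diff line h) (simp_all add: add_ac)
  qed
  then obtain \<xi> where \<xi>: "0 < \<xi>" "\<xi> < t"
    and 1: "h (p + t *\<^sub>R u + t *\<^sub>R v) - h (p + t *\<^sub>R u) - h (p + t *\<^sub>R v) + h p
      = t * (h' (p + \<xi> *\<^sub>R u + t *\<^sub>R v) u - h' (p + \<xi> *\<^sub>R u) u)"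
    by (auto simp: add_ac)
  have "\<exists>\<eta>>0. \<eta> < t \<and> h' (p + \<xi> *\<^sub>R u + t *\<^sub>R v) u - h' (p + \<xi> *\<^sub>R u + 0 *\<^sub>R v) u
      = (t - 0) * hu (p + \<xi> *\<^sub>R u + \<eta> *\<^sub>R v) v"
  proof (rule MVT2[OF t(1)])
    fix s assume s: "0 \<le> s" "s \<le> t"
    show "((\<lambda>s. h' (p + \<xi> *\<^sub>R u + s *\<^sub>R v) u) has_real_derivative hu (p + \<xi> *\<^sub>R u + s *\<^sub>R v) v) (at s)"
      using \<xi> by (intro line hu in_ball s) auto
  qed
  then obtain \<eta> where \<eta>: "0 < \<eta>" "\<eta> < t"
    and 2: "h' (p + \<xi> *\<^sub>R u + t *\<^sub>R v) u - h' (p + \<xi> *\<^sub>R u) u = t * hu (p + \<xi> *\<^sub>R u + \<eta> *\<^sub>R v) v"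
    by auto
  show ?thesis
    using 1 2 near[of \<xi> \<eta>] \<xi> \<eta> by (intro exI[of _ "p + \<xi> *\<^sub>R u + \<eta> *\<^sub>R v"]) auto
qed

text \<open>The derivatives are given as functions, so that the lemma applies directly to functions
  whose derivatives are known by formulas that hold on an open set.\<close>

lemma second_derivative_symmetric:
  fixes h :: "'a::real_normed_vector \<Rightarrow> real"
  assumes S: "open S" "p \<in> S"
    and h: "\<And>q. q \<in> S \<Longrightarrow> (h has_derivative h' q) (at q)"
    and hu: "\<And>q. q \<in> S \<Longrightarrow> ((\<lambda>q. h' q u) has_derivative hu q) (at q)"
    and hv: "\<And>q. q \<in> S \<Longrightarrow> ((\<lambda>q. h' q v) has_derivative hv q) (at q)"
    and cont: "continuous_on S (\<lambda>q. hu q v)" "continuous_on S (\<lambda>q. hv q u)"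
  shows "hu p v = hv p u"
proof (rule ccontr)
  assume n: "hu p v \<noteq> hv p u"
  define \<epsilon> where "\<epsilon> = \<bar>hu p v - hv p u\<bar> / 2"
  have \<epsilon>: "\<epsilon> > 0"
    using n by (simp add: \<epsilon>_def)
  obtain e where e: "e > 0" "ball p e \<subseteq> S"
    using S open_contains_ball by blast
  have "isCont (\<lambda>q. hu q v) p" "isCont (\<lambda>q. hv q u) p"
    using cont S continuous_on_eq_continuous_at by blast+
  then obtain d1 d2 where d: "d1 > 0" "\<And>z. dist z p < d1 \<Longrightarrow> dist (hu z v) (hu p v) < \<epsilon>"
      "d2 > 0" "\<And>z. dist z p < d2 \<Longrightarrow> dist (hv z u) (hv p u) < \<epsilon>"
    using \<epsilon> unfolding continuous_at_eps_delta by metis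
  define m where "m = min e (min d1 d2)"
  define N where "N = norm u + norm v + 1"
  define t where "t = m / (2 * N)"
  have m: "m > 0"
    using e d by (simp add: m_def)
  have N: "N > 0"
    by (simp add: N_def add_nonneg_pos)
  then have t: "t > 0"
    using m by (simp add: t_def)
  have "t * (norm u + norm v) \<le> t * N"
    using t by (simp add: N_def)
  also have "\<dots> = m / 2"
    using N by (simp add: t_def)
  finally have tm: "t * (norm u + norm v) < m"
    using m by simp
  then have te: "t * (norm u + norm v) < e"
    by (simp add: m_def)
  have B: "q \<in> S" if "q \<in> ball p e" for q
    using that e by blast
  obtain z where z: "dist z p \<le> t * (norm u + norm v)"
    "h (p + t *\<^sub>R u + t *\<^sub>R v) - h (p + t *\<^sub>R u) - h (p + t *\<^sub>R v) + h p = t * (t * hu z v)"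
    using second_difference_mean_value[of p e h h' u hu t v, OF h[OF B] hu[OF B] t te] by blast
  obtain z' where z': "dist z' p \<le> t * (norm v + norm u)"
    "h (p + t *\<^sub>R v + t *\<^sub>R u) - h (p + t *\<^sub>R v) - h (p + t *\<^sub>R u) + h p = t * (t * hv z' u)"
    using second_difference_mean_value[of p e h h' v hv t u, OF h[OF B] hv[OF B] t] te
    by (auto simp: add.commute)
  \<comment> \<open>Both points express the same second difference, which is symmetric in \<open>u\<close> and \<open>v\<close>.\<close>
  have "t * (t * hu z v) = t * (t * hv z' u)"
    unfolding z(2)[symmetric] z'(2)[symmetric] by (simp add: add_ac)
  then have eq: "hu z v = hv z' u"
    using t by simp
  have "dist (hu z v) (hu p v) < \<epsilon>" "dist (hv z' u) (hv p u) < \<epsilon>"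
    using z(1) z'(1) tm by (auto intro!: d simp: m_def add.commute)
  then have "\<bar>hu p v - hv p u\<bar> < 2 * \<epsilon>"
    unfolding eq dist_real_def by linarith
  then show False
    by (simp add: \<epsilon>_def)
qed

section \<open>Local isometries\<close>

text \<open>Isometries respect the Levi-Civita connection. As in the Koszul formula, the derivative of
  the isometry identity determines the second derivative of \<open>\<Phi>\<close>, because the latter is
  symmetric.\<close>

lemma isometry_second_derivative:
  assumes f: "smooth_on UNIV f" and U: "open U"
    and iso: "isometry_between (metric_M f) (metric_M f) U V \<Phi>"
    and q: "q \<in> U"
  defines "A \<equiv> \<lambda>q. frechet_derivative \<Phi> (at q)"
  shows "((\<lambda>q. A q u) has_derivative
      (\<lambda>w. A q (Gam (metric_M f) q w u) - Gam (metric_M f) (\<Phi> q) (A q w) (A q u))) (at q)"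
proof -
  let ?g = "metric_M f"
  define B where "B q u = frechet_derivative (\<lambda>q. A q u) (at q)" for q u
  have smooth: "Ck_on (Suc (Suc 0)) U \<Phi>"
    using iso unfolding isometry_between_def smooth_on_def by blast
  have d\<Phi>: "(\<Phi> has_derivative A q) (at q)" if "q \<in> U" for q
    using smooth that unfolding A_def by (simp flip: frechet_derivative_works)
  have dA: "((\<lambda>q. A q u) has_derivative B q u) (at q)" if "q \<in> U" for q u
    using smooth that unfolding A_def B_def by (simp flip: frechet_derivative_works)
  have cB: "continuous_on U (\<lambda>q. B q u w)" for u w
    using smooth unfolding A_def B_def by simp
  have nth: "((\<lambda>q. G q $ i) has_derivative (\<lambda>w. G' w $ i)) F"
    if "(G has_derivative G') F" for G :: "real^3 \<Rightarrow> real^3" and G' F i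
    by (rule bounded_linear.has_derivative[OF bounded_linear_vec_nth that])
  have lin: "linear (A q)"
    using has_derivative_linear[OF d\<Phi>[OF q]] .
  have Bsym: "B q u w = B q w u" for u w
  proof (unfold vec_eq_iff, intro allI)
    fix i
    show "B q u w $ i = B q w u $ i"
      by (rule second_derivative_symmetric[OF U q, of "\<lambda>q. \<Phi> q $ i" "\<lambda>q w. A q w $ i" u "\<lambda>q w. B q u w $ i"
            w "\<lambda>q u. B q w u $ i"])
        (auto intro!: nth d\<Phi> dA continuous_intros cB)
  qed
  have ipA: "ip ?g (\<Phi> q) (A q u) (A q v) = ip ?g q u v" if "q \<in> U" for q u v
    using iso that unfolding isometry_between_def A_def by blast
  define K where "K w u v = ip ?g (\<Phi> q) (B q u w) (A q v)" for w u v
  define E where "E w u v = - 2 * deriv f (\<Phi> q $ 2) * A q w $ 2 * A q u $ 1 * A q v $ 1" for w u v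
  define E0 where "E0 w u v = - 2 * deriv f (q $ 2) * w $ 2 * u $ 1 * v $ 1" for w u v :: "real^3"
  \<comment> \<open>The derivative of the isometry identity in direction \<open>w\<close>.\<close>
  have diff: "E w u v + K w u v + K w v u = E0 w u v" for w u v
  proof -
    have df: "((\<lambda>q. f (\<Phi> q $ 2)) has_derivative (\<lambda>w. deriv f (\<Phi> q $ 2) * A q w $ 2)) (at q)"
      by (rule has_derivative_compose[OF nth[OF d\<Phi>[OF q]] deriv_smooth(1)[OF f, unfolded has_field_derivative_def]])
    have "((\<lambda>q. - 2 * f (\<Phi> q $ 2) * A q u $ 1 * A q v $ 1 + A q u $ 1 * A q v $ 3
        + A q u $ 3 * A q v $ 1 + A q u $ 2 * A q v $ 2) has_derivative
        (\<lambda>w. E w u v + K w u v + K w v u)) (at q)"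
      by (rule has_derivative_eq_rhs, (rule has_derivative_add has_derivative_mult
          has_derivative_mult_right has_derivative_minus df nth dA q)+)
        (simp add: fun_eq_iff E_def K_def ip_metric_M algebra_simps)
    then have "((\<lambda>q. ip ?g (\<Phi> q) (A q u) (A q v)) has_derivative (\<lambda>w. E w u v + K w u v + K w v u)) (at q)"
      by (simp only: ip_metric_M)
    then have 1: "((\<lambda>q. ip ?g q u v) has_derivative (\<lambda>w. E w u v + K w u v + K w v u)) (at q)"
      by (rule has_derivative_transform_within_open[OF _ U q]) (rule ipA)
    have "((\<lambda>q. - 2 * f (q $ 2) * u $ 1 * v $ 1 + u $ 1 * v $ 3 + u $ 3 * v $ 1 + u $ 2 * v $ 2)
        has_derivative (\<lambda>w. E0 w u v)) (at q)"
      by (rule has_derivative_eq_rhs, (rule has_derivative_add has_derivative_mult_left has_derivative_mult_right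
          has_derivative_const has_derivative_profile deriv_smooth(1)[OF f])+)
        (simp add: fun_eq_iff E0_def)
    then have "((\<lambda>q. ip ?g q u v) has_derivative (\<lambda>w. E0 w u v)) (at q)"
      by (simp only: ip_metric_M)
    from fun_cong[OF has_derivative_unique[OF 1 this]] show ?thesis .
  qed
  have Ksym: "K w u v = K u w v" for u v w
    by (simp add: K_def Bsym[of u w])
  \<comment> \<open>The sum over the first two cyclic arrangements minus the third isolates one \<open>K\<close>, by symmetry of \<open>B\<close>.\<close>
  have koszul: "2 * K w u v = (E0 w u v + E0 u w v - E0 v w u) - (E w u v + E u w v - E v w u)" for u v w
    using diff[of w u v] diff[of u w v] diff[of v w u] Ksym[of w u v] Ksym[of w v u] Ksym[of u v w]
    by linarith
  have ipGam: "2 * ip ?g p (Gam ?g p u v) w = - 2 * deriv f (p $ 2) *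
      (u $ 2 * v $ 1 * w $ 1 + v $ 2 * u $ 1 * w $ 1 - w $ 2 * u $ 1 * v $ 1)" for p u v w
    by (simp add: ip_metric_M Gam_metric_M[OF f] algebra_simps)
  have ip_diff: "ip ?g p (a - b) c = ip ?g p a c - ip ?g p b c" for p a b c
    by (simp add: ip_metric_M algebra_simps)
  have inj: "inj (A q)"
  proof (rule linear_injective_0[OF lin, THEN iffD2], intro allI impI)
    fix v assume "A q v = 0"
    then have "ip ?g q v z = ip ?g q 0 z" for z
      using ipA[OF q, of v z] by (simp add: ip_metric_M)
    then show "v = 0"
      by (rule ip_metric_M_nondegenerate)
  qed
  then have surj: "surj (A q)"
    using linear_injective_imp_surjective[OF lin] by blast
  have "B q u w = A q (Gam ?g q w u) - Gam ?g (\<Phi> q) (A q w) (A q u)" for w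
  proof (rule ip_metric_M_nondegenerate[of f "\<Phi> q"])
    fix z
    obtain v where z: "z = A q v"
      using surj by blast
    have "2 * ip ?g (\<Phi> q) (B q u w) z = 2 * ip ?g q (Gam ?g q w u) v - 2 * ip ?g (\<Phi> q) (Gam ?g (\<Phi> q) (A q w) (A q u)) z"
      using koszul[of w u v] unfolding ipGam z by (simp add: K_def E_def E0_def algebra_simps)
    then show "ip ?g (\<Phi> q) (B q u w) z = ip ?g (\<Phi> q) (A q (Gam ?g q w u) - Gam ?g (\<Phi> q) (A q w) (A q u)) z"
      using ipA[OF q] by (simp add: ip_diff z)
  qed
  then have "B q u = (\<lambda>w. A q (Gam ?g q w u) - Gam ?g (\<Phi> q) (A q w) (A q u))"
    by blast
  then show ?thesis
    using dA[OF q, of u] by simp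
qed

lemma has_derivative_vanishing:
  assumes "open U" "q \<in> U" "\<And>q. q \<in> U \<Longrightarrow> G q = (0::real)" "(G has_derivative G') (at q)"
  shows "G' w = 0"
proof -
  have "((\<lambda>_. 0) has_derivative G') (at q)"
    by (rule has_derivative_transform_within_open[OF assms(4,1,2)]) (rule assms(3))
  then show ?thesis
    using has_derivative_unique[OF _ has_derivative_const] by metis
qed

text \<open>The previous formula expresses the derivatives of the Jacobian entries of \<open>\<Phi>\<close> through the
  entries themselves and \<open>f'\<close>. The integrability conditions of this system, that is, the
  symmetry of second derivatives of the entries \<open>a 1 1\<close> and \<open>a 2 1\<close>, yield the relations between
  the derivatives of \<open>f\<close> at a point and at its image, so curvature tensors need not be
  transported along \<open>\<Phi>\<close>. Here \<open>c\<close> and \<open>s\<close> are the diagonal entries for \<open>x\<close> and \<open>y\<close>.\<close>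

lemma local_isometry_invariants:
  assumes f: "smooth_on UNIV f"
    and F: "\<And>y. (deriv ^^ 2) f y \<noteq> 0" "\<And>y. (deriv ^^ 3) f y \<noteq> 0"
    and U: "open U" "P \<in> U"
    and iso: "isometry_between (metric_M f) (metric_M f) U V \<Phi>"
  obtains c s where "c \<noteq> 0" "s\<^sup>2 = 1" "deriv f (P $ 2) * s = deriv f (\<Phi> P $ 2) * c\<^sup>2"
    "(deriv ^^ 2) f (P $ 2) = (deriv ^^ 2) f (\<Phi> P $ 2) * c\<^sup>2"
    "(deriv ^^ 3) f (P $ 2) = (deriv ^^ 3) f (\<Phi> P $ 2) * s * c\<^sup>2"
proof -
  let ?g = "metric_M f"
  define A where "A q = frechet_derivative \<Phi> (at q)" for q
  have smooth: "Ck_on (Suc 0) U \<Phi>"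
    using iso unfolding isometry_between_def smooth_on_def by blast
  have d\<Phi>: "(\<Phi> has_derivative A q) (at q)" if "q \<in> U" for q
    using smooth that unfolding A_def by (simp flip: frechet_derivative_works)
  have lin: "linear (A q)" if "q \<in> U" for q
    using has_derivative_linear[OF d\<Phi>[OF that]] .
  have ipA: "ip ?g (\<Phi> q) (A q u) (A q v) = ip ?g q u v" if "q \<in> U" for q u v
    using iso that unfolding isometry_between_def A_def by blast
  have dA: "((\<lambda>q. A q u) has_derivative
      (\<lambda>w. A q (Gam ?g q w u) - Gam ?g (\<Phi> q) (A q w) (A q u))) (at q)" if "q \<in> U" for q u
    unfolding A_def by (rule isometry_second_derivative[OF f U(1) iso that])
  have nth: "((\<lambda>q. G q $ i) has_derivative (\<lambda>w. G' w $ i)) F"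
    if "(G has_derivative G') F" for G :: "real^3 \<Rightarrow> real^3" and G' F i
    by (rule bounded_linear.has_derivative[OF bounded_linear_vec_nth that])
  \<comment> \<open>The entry in row \<open>k\<close> and column \<open>j\<close> of the Jacobian matrix of \<open>\<Phi>\<close> at \<open>q\<close>.\<close>
  define a where "a k j q = A q (axis j 1) $ k" for k j q
  have expand: "A q v $ k = v $ 1 * a k 1 q + v $ 2 * a k 2 q + v $ 3 * a k 3 q" if "q \<in> U" for q v k
  proof -
    have "v = v $ 1 *\<^sub>R e1 + v $ 2 *\<^sub>R e2 + v $ 3 *\<^sub>R e3"
      by (simp add: vec_eq_iff forall_3)
    then have "A q v = A q (v $ 1 *\<^sub>R e1 + v $ 2 *\<^sub>R e2 + v $ 3 *\<^sub>R e3)"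
      by simp
    then show ?thesis
      by (simp add: linear_add[OF lin[OF that]] linear_scale[OF lin[OF that]] a_def)
  qed
  have da: "(a k j has_derivative (\<lambda>w. (A q (Gam ?g q w (axis j 1)) $ k
      - Gam ?g (\<Phi> q) (A q w) (A q (axis j 1)) $ k))) (at q)" if "q \<in> U" for q k j
    using nth[OF dA[OF that], of _ k] unfolding a_def[abs_def] by simp
  have cont: "continuous_on U (a k j)" for k j
    using da by (meson continuous_at_imp_continuous_on has_derivative_continuous)
  have df: "((\<lambda>q. (deriv ^^ n) f (q $ 2)) has_derivative (\<lambda>w. (deriv ^^ Suc n) f (q $ 2) * w $ 2)) (at q)"
    for n and q :: "real^3"
    by (rule has_derivative_profile[OF deriv_funpow[OF f]])
  have df\<Phi>: "((\<lambda>q. (deriv ^^ n) f (\<Phi> q $ 2)) has_derivative (\<lambda>w. (deriv ^^ Suc n) f (\<Phi> q $ 2) * A q w $ 2)) (at q)"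
    if "q \<in> U" for n q
    by (rule has_derivative_compose[OF nth[OF d\<Phi>[OF that]] deriv_funpow[OF f, unfolded has_field_derivative_def]])
  have n2: "deriv (deriv f) = (deriv ^^ 2) f" and n3: "deriv ((deriv ^^ 2) f) = (deriv ^^ 3) f"
    by (simp_all add: eval_nat_numeral)
  have cf: "continuous_on U (\<lambda>q. (deriv ^^ n) f (q $ 2))" for n
    using df by (meson continuous_at_imp_continuous_on has_derivative_continuous)
  have cf\<Phi>: "continuous_on U (\<lambda>q. (deriv ^^ n) f (\<Phi> q $ 2))" for n
    using df\<Phi> by (meson continuous_at_imp_continuous_on has_derivative_continuous)
  have da11: "(a 1 1 has_derivative (\<lambda>w. deriv f (q $ 2) * (w $ 1 * a 1 2 q - w $ 2 * a 1 3 q))) (at q)"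
    and da12: "(a 1 2 has_derivative (\<lambda>w. - deriv f (q $ 2) * w $ 1 * a 1 3 q)) (at q)"
    and da13: "(a 1 3 has_derivative (\<lambda>w. 0)) (at q)" if "q \<in> U" for q
    using da[OF that, of 1 1] da[OF that, of 1 2] da[OF that, of 1 3]
    by (simp_all add: Gam_metric_M[OF f] expand[OF that] algebra_simps)
  have d1: "((\<lambda>q. deriv f (q $ 2) * a 1 2 q) has_derivative
      (\<lambda>w. deriv f (q $ 2) * (- deriv f (q $ 2) * w $ 1 * a 1 3 q) + (deriv ^^ 2) f (q $ 2) * w $ 2 * a 1 2 q)) (at q)"
    if "q \<in> U" for q
    using has_derivative_mult[OF df[of 1] da12[OF that]] by (simp add: n2)
  have d2: "((\<lambda>q. - (deriv f (q $ 2) * a 1 3 q)) has_derivative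
      (\<lambda>w. - (deriv f (q $ 2) * 0 + (deriv ^^ 2) f (q $ 2) * w $ 2 * a 1 3 q))) (at q)"
    if "q \<in> U" for q
    using has_derivative_minus[OF has_derivative_mult[OF df[of 1] da13[OF that]]] by (simp add: n2)
  have cont': "continuous_on U (\<lambda>q. deriv f (q $ 2))" "continuous_on U (\<lambda>q. deriv f (\<Phi> q $ 2))"
    using cf[of 1] cf\<Phi>[of 1] by simp_all
  \<comment> \<open>Equality of the mixed second derivatives of \<open>a 1 1\<close>; then vanishing of the derivatives of \<open>a 1 2\<close>.\<close>
  have a12: "a 1 2 q = 0" if q: "q \<in> U" for q
  proof -
    have "deriv f (q $ 2) * (- deriv f (q $ 2) * e2 $ 1 * a 1 3 q) + (deriv ^^ 2) f (q $ 2) * e2 $ 2 * a 1 2 q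
       = - (deriv f (q $ 2) * 0 + (deriv ^^ 2) f (q $ 2) * e1 $ 2 * a 1 3 q)"
      by (rule second_derivative_symmetric[OF U(1) q da11, of e1 _ e2])
        (auto intro!: d1[simplified] d2[simplified] continuous_intros cont cont' cf)
    then show ?thesis
      using F(1) by simp
  qed
  have a13: "a 1 3 q = 0" if q: "q \<in> U" for q
  proof -
    have "- deriv f (q $ 2) * e1 $ 1 * a 1 3 q = 0" if "q \<in> U" for q
      by (rule has_derivative_vanishing[OF U(1) that _ da12[OF that]]) (rule a12)
    then have "- (deriv f (q $ 2) * 0 + (deriv ^^ 2) f (q $ 2) * e2 $ 2 * a 1 3 q) = 0"
      by (intro has_derivative_vanishing[OF U(1) q _ d2[OF q]]) simp
    then show ?thesis
      using F(1) by simp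
  qed
  \<comment> \<open>The pull-back of \<open>dx\<close> under \<open>\<Phi>\<close> is \<open>c dx\<close>, and \<open>c = a 1 1\<close> is locally constant.\<close>
  have dc: "(a 1 1 has_derivative (\<lambda>w. 0)) (at q)" if "q \<in> U" for q
    using da11[OF that] by (simp add: a12[OF that] a13[OF that])
  have a23: "a 2 3 q = 0" and s: "(a 2 2 q)\<^sup>2 = 1" and c: "a 1 1 q \<noteq> 0" if "q \<in> U" for q
    using ipA[OF that, of e3 e3] ipA[OF that, of e2 e2] ipA[OF that, of e1 e3] a12[OF that] a13[OF that]
    by (auto simp: ip_metric_M power2_eq_square a_def)
  have da21: "(a 2 1 has_derivative
        (\<lambda>w. w $ 1 * (deriv f (q $ 2) * a 2 2 q - deriv f (\<Phi> q $ 2) * (a 1 1 q)\<^sup>2))) (at q)"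
    and da22: "(a 2 2 has_derivative (\<lambda>w. 0)) (at q)" if "q \<in> U" for q
    using da[OF that, of 2 1] da[OF that, of 2 2] a12[OF that] a13[OF that] a23[OF that]
    by (simp_all add: Gam_metric_M[OF f] expand[OF that] algebra_simps power2_eq_square)
  have dc2: "((\<lambda>q. (a 1 1 q)\<^sup>2) has_derivative (\<lambda>w. 0)) (at q)" if "q \<in> U" for q
    using has_derivative_mult[OF dc[OF that] dc[OF that]] by (simp add: power2_eq_square)
  have A2: "A q w $ 2 = w $ 1 * a 2 1 q + w $ 2 * a 2 2 q" if "q \<in> U" for q w
    by (simp add: expand[OF that] a23[OF that])
  have df\<Phi>c: "((\<lambda>q. (deriv ^^ n) f (\<Phi> q $ 2) * (a 1 1 q)\<^sup>2) has_derivative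
      (\<lambda>w. (deriv ^^ Suc n) f (\<Phi> q $ 2) * (w $ 1 * a 2 1 q + w $ 2 * a 2 2 q) * (a 1 1 q)\<^sup>2)) (at q)"
    if "q \<in> U" for n q
    using has_derivative_mult[OF df\<Phi>[OF that, of n] dc2[OF that]] by (simp add: A2[OF that])
  have d3: "((\<lambda>q. deriv f (q $ 2) * a 2 2 q - deriv f (\<Phi> q $ 2) * (a 1 1 q)\<^sup>2) has_derivative
      (\<lambda>w. (deriv ^^ 2) f (q $ 2) * w $ 2 * a 2 2 q
         - (deriv ^^ 2) f (\<Phi> q $ 2) * (w $ 1 * a 2 1 q + w $ 2 * a 2 2 q) * (a 1 1 q)\<^sup>2)) (at q)"
    if "q \<in> U" for q
    using has_derivative_diff[OF has_derivative_mult[OF df[of 1] da22[OF that]] df\<Phi>c[OF that, of 1]]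
    by (simp add: n2)
  \<comment> \<open>Equality of the mixed second derivatives of \<open>a 2 1\<close>.\<close>
  have F2: "(deriv ^^ 2) f (q $ 2) - (deriv ^^ 2) f (\<Phi> q $ 2) * (a 1 1 q)\<^sup>2 = 0" if q: "q \<in> U" for q
  proof -
    have "(deriv ^^ 2) f (q $ 2) * e2 $ 2 * a 2 2 q
         - (deriv ^^ 2) f (\<Phi> q $ 2) * (e2 $ 1 * a 2 1 q + e2 $ 2 * a 2 2 q) * (a 1 1 q)\<^sup>2 = 0"
      by (rule second_derivative_symmetric[OF U(1) q da21, of e1 _ e2 "\<lambda>_ _. 0"])
        (auto intro!: d3[simplified] continuous_intros cont cont' cf cf\<Phi>)
    then have "a 2 2 q * ((deriv ^^ 2) f (q $ 2) - (deriv ^^ 2) f (\<Phi> q $ 2) * (a 1 1 q)\<^sup>2) = 0"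
      by (simp add: algebra_simps)
    moreover have "a 2 2 q \<noteq> 0"
      using s[OF q] by auto
    ultimately show ?thesis
      by simp
  qed
  \<comment> \<open>The derivative of the identity just obtained: direction \<open>e2\<close> gives the claim on the third
    derivative of \<open>f\<close>, direction \<open>e1\<close> the vanishing of \<open>a 2 1\<close>.\<close>
  have F3: "(deriv ^^ 3) f (q $ 2) * w $ 2
      - (deriv ^^ 3) f (\<Phi> q $ 2) * (w $ 1 * a 2 1 q + w $ 2 * a 2 2 q) * (a 1 1 q)\<^sup>2 = 0"
    if q: "q \<in> U" for q and w :: "real^3"
    using has_derivative_vanishing[OF U(1) q F2 has_derivative_diff[OF df[of 2] df\<Phi>c[OF q, of 2]], of w]
    by (simp add: n3)
  have a21: "a 2 1 q = 0" if q: "q \<in> U" for q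
    using F3[OF q, of e1] F(2) c[OF q] by simp
  have F1: "e1 $ 1 * (deriv f (P $ 2) * a 2 2 P - deriv f (\<Phi> P $ 2) * (a 1 1 P)\<^sup>2) = 0"
    by (rule has_derivative_vanishing[OF U _ da21[OF U(2)]]) (rule a21)
  show thesis
    by (rule that[OF c[OF U(2)] s[OF U(2)]])
      (use F1 F2[OF U(2)] F3[OF U(2), of e2] in simp_all)
qed

text \<open>The factors of \<open>f'\<close>, \<open>f''\<close>, \<open>f'''\<close> combine so that \<open>f' f''' / f''\<^sup>2\<close> is invariant.\<close>

lemma locally_homogeneous_imp_exp:
  assumes f: "smooth_on UNIV f"
    and F: "\<And>y. (deriv ^^ 2) f y \<noteq> 0" "\<And>y. (deriv ^^ 3) f y \<noteq> 0"
    and hom: "locally_homogeneous (metric_M f)"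
  shows "\<exists>a b. \<forall>y. deriv f y = a * exp (b * y)"
proof (rule ratio_const_imp_exp[OF f F])
  fix x y :: real
  obtain U V \<Phi> where U: "open U" "x *\<^sub>R e2 \<in> U" and iso: "isometry_between (metric_M f) (metric_M f) U V \<Phi>"
    and \<Phi>: "\<Phi> (x *\<^sub>R e2) = y *\<^sub>R e2"
    using hom unfolding locally_homogeneous_def by metis
  obtain c s where c: "c \<noteq> 0" and s: "s\<^sup>2 = 1"
    and "deriv f ((x *\<^sub>R e2) $ 2) * s = deriv f (\<Phi> (x *\<^sub>R e2) $ 2) * c\<^sup>2"
    "(deriv ^^ 2) f ((x *\<^sub>R e2) $ 2) = (deriv ^^ 2) f (\<Phi> (x *\<^sub>R e2) $ 2) * c\<^sup>2"
    "(deriv ^^ 3) f ((x *\<^sub>R e2) $ 2) = (deriv ^^ 3) f (\<Phi> (x *\<^sub>R e2) $ 2) * s * c\<^sup>2"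
    by (rule local_isometry_invariants[OF f F U iso])
  then have 1: "deriv f x * s = deriv f y * c\<^sup>2" and 2: "(deriv ^^ 2) f x = (deriv ^^ 2) f y * c\<^sup>2"
    and 3: "(deriv ^^ 3) f x = (deriv ^^ 3) f y * s * c\<^sup>2"
    by (simp_all add: \<Phi>)
  have "deriv f x * (deriv ^^ 3) f x = (deriv f x * s) * (deriv ^^ 3) f y * c\<^sup>2"
    by (simp add: 3)
  also have "\<dots> = (deriv f y * (deriv ^^ 3) f y) * (c\<^sup>2)\<^sup>2"
    by (simp add: 1 power2_eq_square)
  finally show "deriv f x * (deriv ^^ 3) f x / ((deriv ^^ 2) f x)\<^sup>2 =
      deriv f y * (deriv ^^ 3) f y / ((deriv ^^ 2) f y)\<^sup>2"
    using c by (simp add: 2 power_mult_distrib)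
qed

section \<open>The classification\<close>

theorem theorem1p2:
  fixes f :: "real \<Rightarrow> real"
  assumes smooth: "smooth_on UNIV f"
  shows
    "(\<forall>I. scalar_weyl_invariant (metric_M f) I \<longrightarrow> (\<forall>p. I p = 0)) \<and>
     (\<forall>\<epsilon>\<in>{1, -1}. local_symmetric (metric_S \<epsilon>) \<and> indecomposable (metric_S \<epsilon>)) \<and>
     ((\<forall>y. (deriv ^^ 2) f y \<noteq> 0) \<longrightarrow>
        (\<exists>\<epsilon>\<in>{1, -1}. (\<forall>y. sgn ((deriv ^^ 2) f y) = \<epsilon>) \<and>
           zero_curvature_modeled_on (metric_M f) (metric_S \<epsilon>))) \<and>
     ((\<forall>y. (deriv ^^ 2) f y \<noteq> 0 \<and> (deriv ^^ 3) f y \<noteq> 0) \<longrightarrow>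
        affine_curvature_homogeneous 1 (metric_M f) \<and>
        (curvature_homogeneous 1 (metric_M f) \<longleftrightarrow>
           (\<exists>a b. \<forall>y. (deriv ^^ 2) f y = a * exp (b * y))) \<and>
        (locally_homogeneous (metric_M f) \<longleftrightarrow> (\<forall>k. curvature_homogeneous k (metric_M f))) \<and>
        ((\<forall>k. curvature_homogeneous k (metric_M f)) \<longleftrightarrow> curvature_homogeneous 2 (metric_M f)) \<and>
        (curvature_homogeneous 2 (metric_M f) \<longleftrightarrow> affine_curvature_homogeneous 2 (metric_M f)) \<and>
        (affine_curvature_homogeneous 2 (metric_M f) \<longleftrightarrow>
           (\<exists>a b. \<forall>y. deriv f y = a * exp (b * y))))"
proof (intro conjI impI)
  show "\<forall>I. scalar_weyl_invariant (metric_M f) I \<longrightarrow> (\<forall>p. I p = 0)"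
    using scalar_weyl_invariant_metric_M[OF smooth] by blast
  show "\<forall>\<epsilon>\<in>{1, -1}. local_symmetric (metric_S \<epsilon>) \<and> indecomposable (metric_S \<epsilon>)"
    by (simp add: local_symmetric_S indecomposable_S)
next
  assume F: "\<forall>y. (deriv ^^ 2) f y \<noteq> 0"
  define \<epsilon> where "\<epsilon> = sgn ((deriv ^^ 2) f 0)"
  have "\<epsilon> \<in> {1, -1}"
    using F by (auto simp: \<epsilon>_def sgn_if)
  moreover have "sgn ((deriv ^^ 2) f y) = \<epsilon>" for y
    unfolding \<epsilon>_def using F
    by (intro nonvanishing_sgn_const) (auto intro: DERIV_isCont[OF deriv_2_smooth[OF smooth]])
  ultimately show "\<exists>\<epsilon>\<in>{1, -1}. (\<forall>y. sgn ((deriv ^^ 2) f y) = \<epsilon>) \<and>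
           zero_curvature_modeled_on (metric_M f) (metric_S \<epsilon>)"
    using zero_curvature_modeled_on_S[OF smooth] by blast
next
  assume "\<forall>y. (deriv ^^ 2) f y \<noteq> 0 \<and> (deriv ^^ 3) f y \<noteq> 0"
  then have F: "(deriv ^^ 2) f y \<noteq> 0" "(deriv ^^ 3) f y \<noteq> 0" for y
    by blast+
  let ?exp = "\<exists>a b. \<forall>y. deriv f y = a * exp (b * y)"
  show "affine_curvature_homogeneous 1 (metric_M f)"
    by (rule affine_1_homogeneous[OF smooth F])
  show "curvature_homogeneous 1 (metric_M f) \<longleftrightarrow> (\<exists>a b. \<forall>y. (deriv ^^ 2) f y = a * exp (b * y))"
    using curvature_1_homogeneous_imp_exp[OF smooth F] curvature_1_homogeneous_of_exp[OF smooth] by blast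
  have i_v: "locally_homogeneous (metric_M f) \<Longrightarrow> ?exp"
    by (rule locally_homogeneous_imp_exp[OF smooth F])
  have v_i: "?exp \<Longrightarrow> locally_homogeneous (metric_M f)"
    using locally_homogeneous_of_exp[OF smooth] by blast
  have v_ii: "?exp \<Longrightarrow> curvature_homogeneous k (metric_M f)" for k
    using curvature_homogeneous_of_exp[OF smooth] by blast
  have iii_iv: "curvature_homogeneous 2 (metric_M f) \<Longrightarrow> affine_curvature_homogeneous 2 (metric_M f)"
    by (rule curvature_homogeneous_imp_affine[OF smooth])
  have iv_v: "affine_curvature_homogeneous 2 (metric_M f) \<Longrightarrow> ?exp"
    by (rule affine_2_homogeneous_imp_exp[OF smooth F])
  show "locally_homogeneous (metric_M f) \<longleftrightarrow> (\<forall>k. curvature_homogeneous k (metric_M f))"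
    using i_v v_i v_ii iii_iv iv_v by blast
  show "(\<forall>k. curvature_homogeneous k (metric_M f)) \<longleftrightarrow> curvature_homogeneous 2 (metric_M f)"
    using v_ii iii_iv iv_v by blast
  show "curvature_homogeneous 2 (metric_M f) \<longleftrightarrow> affine_curvature_homogeneous 2 (metric_M f)"
    using v_ii iii_iv iv_v by blast
  show "affine_curvature_homogeneous 2 (metric_M f) \<longleftrightarrow> ?exp"
    using v_ii iii_iv iv_v by blast
qed

end
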